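(* For even $\eta\ge4$, let $P=\left(\frac{\eta-1}2,\frac{\eta-1}2\right)$. Suppose $\varphi$ is a scaling function for an MRA of $L^2(\mathbb R^2,\mathbb R_2)$ which is supported on $[0,\eta-1]^2$, and let $m_0$ be the associated scaling filter. Then the following statements are equivalent: (a) $\varphi(x)=\varphi(2P-x)$; (b) $\hat\varphi(\xi)=e^{4\pi\xi\wedge P}\hat\varphi(-\xi)$; (c) $m_0(\xi)=e^{4\pi\xi\wedge P}m_0(-\xi)$. (Here (a) is for all $x\in\mathbb R^2$, and (b), (c) are for all $\xi\in\mathbb R^2$.)
   Context: Quaternions: $\mathbb R_2=\{x_0+x_1e_1+x_2e_2+x_{12}e_{12}: x_0,x_1,x_2,x_{12}\in\mathbb R\}$ with $e_1^2=e_2^2=e_{12}^2=e_1e_2e_{12}=-1$ (so $e_{12}=e_1e_2=-e_2e_1$). For $x,y\in\mathbb R^2$, $x\wedge y=e_{12}(x_1y_2-x_2y_1)$. Quaternionic Fourier transform: $\hat f(\xi)=\int_{\mathbb R^2}e^{2\pi\xi\wedge x}f(x)\,dx$ (extended to $L^2$). A multiresolution analysis (MRA) for $L^2(\mathbb R^2,\mathbb R_2)$ is a sequence of closed right $\mathbb R_2$-linear submodules $(V_j)_{j\in\mathbb Z}$ and a scaling function $\varphi\in V_0$ with: $V_j\subset V_{j+1}$; $\overline{\bigcup_jV_j}=L^2(\mathbb R^2,\mathbb R_2)$ and $\bigcap_jV_j=\{0\}$; $f\in V_0\iff f(\cdot-k)\in V_0$ for all $k\in\mathbb Z^2$; $f\in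 V_0\iff f(2^j\cdot)\in V_j$ for all $j\in\mathbb Z$; $\{\varphi(\cdot-k)\}_{k\in\mathbb Z^2}$ is an orthonormal basis of $V_0$. The coefficients $(a_k^0)_{k\in\mathbb Z^2}\in\ell^2(\mathbb Z^2,\mathbb R_2)$ are defined by $\frac14\varphi(\frac x2)=\sum_{k\in\mathbb Z^2}\varphi(x-k)a_k^0$, and the scaling filter is $m_0(\xi)=\sum_{k\in\mathbb Z^2}e^{2\pi\xi\wedge k}a_k^0$. *)

theory Defs
  imports "HOL-Analysis.Analysis"
begin

section \<open>Quaternions\<close>

text \<open>
  \<^term>\<open>Quat a b c d\<close> stands for $a + b e_1 + c e_2 + d e_{12}$. The type is made a normed algebra,
  so that the library's \<^const>\<open>exp\<close> is the quaternionic exponential, and a Euclidean space, so that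
  the Bochner integral and Borel measurability are available for quaternion-valued functions.
\<close>

datatype quat = Quat (qre: real) (qe1: real) (qe2: real) (qe12: real)

lemma quat_eq_iff: "x = y \<longleftrightarrow> qre x = qre y \<and> qe1 x = qe1 y \<and> qe2 x = qe2 y \<and> qe12 x = qe12 y"
  by (cases x; cases y) simp

instantiation quat :: ring_1
begin

definition zero_quat :: quat where "0 = Quat 0 0 0 0"
definition one_quat :: quat where "1 = Quat 1 0 0 0"
definition plus_quat :: "quat \<Rightarrow> quat \<Rightarrow> quat" where
  "x + y = Quat (qre x + qre y) (qe1 x + qe1 y) (qe2 x + qe2 y) (qe12 x + qe12 y)"
definition minus_quat :: "quat \<Rightarrow> quat \<Rightarrow> quat" where
  "x - y = Quat (qre x - qre y) (qe1 x - qe1 y) (qe2 x - qe2 y) (qe12 x - qe12 y)"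
definition uminus_quat :: "quat \<Rightarrow> quat" where
  "- x = Quat (- qre x) (- qe1 x) (- qe2 x) (- qe12 x)"
definition times_quat :: "quat \<Rightarrow> quat \<Rightarrow> quat" where
  "x * y = Quat
     (qre x * qre y - qe1 x * qe1 y - qe2 x * qe2 y - qe12 x * qe12 y)
     (qre x * qe1 y + qe1 x * qre y + qe2 x * qe12 y - qe12 x * qe2 y)
     (qre x * qe2 y - qe1 x * qe12 y + qe2 x * qre y + qe12 x * qe1 y)
     (qre x * qe12 y + qe1 x * qe2 y - qe2 x * qe1 y + qe12 x * qre y)"

instance
  by standard
    (auto simp: zero_quat_def one_quat_def plus_quat_def minus_quat_def
      uminus_quat_def times_quat_def algebra_simps)

end

lemma quat_sel_simps [simp]:
  "qre 0 = 0" "qe1 0 = 0" "qe2 0 = 0" "qe12 0 = 0"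
  "qre 1 = 1" "qe1 1 = 0" "qe2 1 = 0" "qe12 1 = 0"
  "qre (x + y) = qre x + qre y" "qe1 (x + y) = qe1 x + qe1 y"
  "qe2 (x + y) = qe2 x + qe2 y" "qe12 (x + y) = qe12 x + qe12 y"
  "qre (x - y) = qre x - qre y" "qe1 (x - y) = qe1 x - qe1 y"
  "qe2 (x - y) = qe2 x - qe2 y" "qe12 (x - y) = qe12 x - qe12 y"
  "qre (- x) = - qre x" "qe1 (- x) = - qe1 x" "qe2 (- x) = - qe2 x" "qe12 (- x) = - qe12 x"
  by (simp_all add: zero_quat_def one_quat_def plus_quat_def minus_quat_def uminus_quat_def)

instantiation quat :: real_algebra_1
begin

definition scaleR_quat :: "real \<Rightarrow> quat \<Rightarrow> quat" where
  "r *\<^sub>R x = Quat (r * qre x) (r * qe1 x) (r * qe2 x) (r * qe12 x)"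

instance
  by standard
    (auto simp: scaleR_quat_def times_quat_def plus_quat_def one_quat_def algebra_simps)

end

instantiation quat :: real_normed_vector
begin

definition norm_quat :: "quat \<Rightarrow> real" where
  "norm x = sqrt ((qre x)\<^sup>2 + (qe1 x)\<^sup>2 + (qe2 x)\<^sup>2 + (qe12 x)\<^sup>2)"
definition sgn_quat_def:
  "sgn (x :: quat) = x /\<^sub>R norm x"
definition dist_quat_def:
  "dist (x :: quat) y = norm (x - y)"
definition uniformity_quat_def:
  "(uniformity :: (quat \<times> quat) filter) = (INF e\<in>{0 <..}. principal {(x, y). dist x y < e})"
definition open_quat_def:
  "open (U :: quat set) \<longleftrightarrow> (\<forall>x\<in>U. eventually (\<lambda>(x', y). x' = x \<longrightarrow> y \<in> U) uniformity)"

instance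
proof
  fix x y :: quat and r :: real and U :: "quat set"
  show "dist x y = norm (x - y)" by (rule dist_quat_def)
  show "sgn x = x /\<^sub>R norm x" by (rule sgn_quat_def)
  show "uniformity = (INF e\<in>{0 <..}. principal {(x :: quat, y). dist x y < e})"
    by (rule uniformity_quat_def)
  show "open U \<longleftrightarrow> (\<forall>x\<in>U. eventually (\<lambda>(x', y). x' = x \<longrightarrow> y \<in> U) uniformity)"
    by (rule open_quat_def)
  show "norm x = 0 \<longleftrightarrow> x = 0"
    by (simp add: norm_quat_def quat_eq_iff add_nonneg_eq_0_iff conj_assoc)
  have *: "norm z = norm ((qre z, qe1 z), (qe2 z, qe12 z))" for z
    by (simp add: norm_quat_def norm_Pair)
  show "norm (x + y) \<le> norm x + norm y"
    using norm_triangle_ineq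
      [of "((qre x, qe1 x), (qe2 x, qe12 x))" "((qre y, qe1 y), (qe2 y, qe12 y))"]
    by (simp add: *)
  have "norm (r *\<^sub>R x) = sqrt (r\<^sup>2 * ((qre x)\<^sup>2 + (qe1 x)\<^sup>2 + (qe2 x)\<^sup>2 + (qe12 x)\<^sup>2))"
    by (simp add: norm_quat_def scaleR_quat_def power_mult_distrib algebra_simps)
  then show "norm (r *\<^sub>R x) = \<bar>r\<bar> * norm x"
    by (simp add: norm_quat_def real_sqrt_mult)
qed

end

instantiation quat :: real_inner
begin

definition inner_quat :: "quat \<Rightarrow> quat \<Rightarrow> real" where
  "x \<bullet> y = qre x * qre y + qe1 x * qe1 y + qe2 x * qe2 y + qe12 x * qe12 y"

instance
proof
  fix x y z :: quat and r :: real
  show "x \<bullet> y = y \<bullet> x" by (simp add: inner_quat_def mult.commute)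
  show "(x + y) \<bullet> z = x \<bullet> z + y \<bullet> z" by (simp add: inner_quat_def algebra_simps)
  show "r *\<^sub>R x \<bullet> y = r * (x \<bullet> y)" by (simp add: inner_quat_def scaleR_quat_def algebra_simps)
  show "0 \<le> x \<bullet> x" by (simp add: inner_quat_def)
  show "x \<bullet> x = 0 \<longleftrightarrow> x = 0"
    by (simp add: inner_quat_def quat_eq_iff add_nonneg_eq_0_iff conj_assoc)
  show "norm x = sqrt (x \<bullet> x)" by (simp add: norm_quat_def inner_quat_def power2_eq_square)
qed

end

instance quat :: real_normed_algebra_1
proof
  fix x y :: quat
  have "(norm (x * y))\<^sup>2 = (norm x * norm y)\<^sup>2"
    by (simp add: norm_quat_def power_mult_distrib times_quat_def)
       (simp add: power2_eq_square algebra_simps)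
  then have "norm (x * y) = norm x * norm y"
    by (simp add: power2_eq_iff_nonneg)
  then show "norm (x * y) \<le> norm x * norm y" by simp
  show "norm (1::quat) = 1" by (simp add: norm_quat_def)
qed

definition e1 :: quat where "e1 = Quat 0 1 0 0"
definition e2 :: quat where "e2 = Quat 0 0 1 0"
definition e12 :: quat where "e12 = Quat 0 0 0 1"

lemma quat_relations:
  "e1 * e1 = -1" "e2 * e2 = -1" "e12 * e12 = -1" "e1 * e2 * e12 = -1"
  "e1 * e2 = e12" "e2 * e1 = - e12"
  by (simp_all add: e1_def e2_def e12_def quat_eq_iff times_quat_def)

instantiation quat :: euclidean_space
begin

definition Basis_quat :: "quat set" where "Basis = {1, e1, e2, e12}"

instance
proof
  show "(Basis :: quat set) \<noteq> {}" "finite (Basis :: quat set)"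
    by (simp_all add: Basis_quat_def)
  show "u \<bullet> v = (if u = v then 1 else 0)" if "u \<in> Basis" "v \<in> Basis" for u v :: quat
    using that unfolding Basis_quat_def e1_def e2_def e12_def one_quat_def
    by (elim insertE emptyE) (simp_all add: inner_quat_def)
  show "(\<forall>u\<in>Basis. x \<bullet> u = 0) \<longleftrightarrow> x = 0" for x :: quat
    by (cases x) (simp add: Basis_quat_def e1_def e2_def e12_def inner_quat_def zero_quat_def)
qed

end

definition quat_cnj :: "quat \<Rightarrow> quat" where
  "quat_cnj x = Quat (qre x) (- qe1 x) (- qe2 x) (- qe12 x)"


section \<open>Quaternion-valued square-integrable functions on the plane\<close>

text \<open>
  Elements of $L^2$ are represented by functions rather than by classes modulo null sets, so
  equality in $L^2$ is almost-everywhere equality, and the zero subspace is the set of all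
  functions vanishing almost everywhere.
\<close>

definition L2 :: "(real^2 \<Rightarrow> quat) set" where
  "L2 = {f. f \<in> borel_measurable lebesgue \<and> integrable lebesgue (\<lambda>x. (norm (f x))\<^sup>2)}"

definition L2_norm :: "(real^2 \<Rightarrow> quat) \<Rightarrow> real" where
  "L2_norm f = sqrt (LINT x|lebesgue. (norm (f x))\<^sup>2)"

text \<open>The conjugate is on the left factor, so the product is right linear in its second argument.\<close>

definition L2_inner :: "(real^2 \<Rightarrow> quat) \<Rightarrow> (real^2 \<Rightarrow> quat) \<Rightarrow> quat" where
  "L2_inner f g = (LINT x|lebesgue. quat_cnj (f x) * g x)"

definition L2_closure :: "(real^2 \<Rightarrow> quat) set \<Rightarrow> (real^2 \<Rightarrow> quat) set" where
  "L2_closure A =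
     {f \<in> L2. \<exists>s :: nat \<Rightarrow> real^2 \<Rightarrow> quat. (\<forall>n. s n \<in> A) \<and> (\<lambda>n. L2_norm (\<lambda>x. s n x - f x)) \<longlonglongrightarrow> 0}"

definition closed_right_submodule :: "(real^2 \<Rightarrow> quat) set \<Rightarrow> bool" where
  "closed_right_submodule V \<longleftrightarrow>
     V \<subseteq> L2 \<and> (\<lambda>x. 0) \<in> V \<and>
     (\<forall>f\<in>V. \<forall>g\<in>V. (\<lambda>x. f x + g x) \<in> V) \<and>
     (\<forall>f\<in>V. \<forall>c. (\<lambda>x. f x * c) \<in> V) \<and>
     L2_closure V = V"

definition right_span :: "('k \<Rightarrow> real^2 \<Rightarrow> quat) \<Rightarrow> (real^2 \<Rightarrow> quat) set" where
  "right_span b = {(\<lambda>x. \<Sum>k\<in>F. b k x * c k) | F c. finite F}"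

definition L2_orthonormal_basis ::
  "('k \<Rightarrow> real^2 \<Rightarrow> quat) \<Rightarrow> (real^2 \<Rightarrow> quat) set \<Rightarrow> bool" where
  "L2_orthonormal_basis b V \<longleftrightarrow>
     (\<forall>k. b k \<in> V) \<and>
     (\<forall>k l. L2_inner (b k) (b l) = (if k = l then 1 else 0)) \<and>
     L2_closure (right_span b) = V"

text \<open>Unconditional convergence in the $L^2$ norm of a family of functions.\<close>

definition L2_has_sum :: "('k \<Rightarrow> real^2 \<Rightarrow> quat) \<Rightarrow> (real^2 \<Rightarrow> quat) \<Rightarrow> bool" where
  "L2_has_sum g f \<longleftrightarrow>
     ((\<lambda>F. L2_norm (\<lambda>x. (\<Sum>k\<in>F. g k x) - f x)) \<longlongrightarrow> 0) (finite_subsets_at_top UNIV)"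


section \<open>The quaternionic Fourier transform\<close>

definition wedge :: "real^2 \<Rightarrow> real^2 \<Rightarrow> quat" (infixl \<open>\<^bold>\<and>\<close> 70) where
  "x \<^bold>\<and> y = (x $ 1 * y $ 2 - x $ 2 * y $ 1) *\<^sub>R e12"

text \<open>
  This is the integral form of the transform. A compactly supported function in $L^2$ is also in
  $L^1$, so for such functions the extension of the transform to $L^2$ is given by this absolutely
  convergent integral, which moreover has a value at every point.
\<close>

definition qft :: "(real^2 \<Rightarrow> quat) \<Rightarrow> real^2 \<Rightarrow> quat" where
  "qft f \<xi> = (LINT x|lebesgue. exp ((2 * pi) *\<^sub>R (\<xi> \<^bold>\<and> x)) * f x)"


section \<open>Multiresolution analyses\<close>

definition lattice_vec :: "int^2 \<Rightarrow> real^2" where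
  "lattice_vec k = (\<chi> i. of_int (k $ i))"

text \<open>The sequence \<^term>\<open>V\<close> is a multiresolution analysis with scaling function \<^term>\<open>\<phi>\<close>.\<close>

definition MRA :: "(int \<Rightarrow> (real^2 \<Rightarrow> quat) set) \<Rightarrow> (real^2 \<Rightarrow> quat) \<Rightarrow> bool" where
  "MRA V \<phi> \<longleftrightarrow>
     (\<forall>j. closed_right_submodule (V j)) \<and>
     \<phi> \<in> V 0 \<and>
     (\<forall>j. V j \<subseteq> V (j + 1)) \<and>
     L2_closure (\<Union>j. V j) = L2 \<and>
     (\<Inter>j. V j) = {f \<in> L2. AE x in lebesgue. f x = 0} \<and>
     (\<forall>f k. f \<in> V 0 \<longleftrightarrow> (\<lambda>x. f (x - lattice_vec k)) \<in> V 0) \<and>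
     (\<forall>f j. f \<in> V 0 \<longleftrightarrow> (\<lambda>x. f ((2 powi j) *\<^sub>R x)) \<in> V j) \<and>
     L2_orthonormal_basis (\<lambda>k x. \<phi> (x - lattice_vec k)) (V 0)"

text \<open>
  For a scaling function the coefficients exist and are unique, because $\varphi(\cdot/2)$ belongs
  to $V_{-1} \subseteq V_0$ and the translates of $\varphi$ form an orthonormal basis of $V_0$.
\<close>

definition scaling_coeffs :: "(real^2 \<Rightarrow> quat) \<Rightarrow> int^2 \<Rightarrow> quat" where
  "scaling_coeffs \<phi> =
     (THE a. (\<lambda>k. (norm (a k))\<^sup>2) summable_on UNIV \<and>
             L2_has_sum (\<lambda>k x. \<phi> (x - lattice_vec k) * a k) (\<lambda>x. (1/4) *\<^sub>R \<phi> ((1/2) *\<^sub>R x)))"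

text \<open>
  The sum is taken pointwise. If $\varphi$ is compactly supported, only finitely many coefficients
  are nonzero, so the sum is finite and defined for every $\xi$.
\<close>

definition scaling_filter :: "(real^2 \<Rightarrow> quat) \<Rightarrow> real^2 \<Rightarrow> quat" where
  "scaling_filter \<phi> \<xi> =
     (\<Sum>\<^sub>\<infinity>k\<in>UNIV. exp ((2 * pi) *\<^sub>R (\<xi> \<^bold>\<and> lattice_vec k)) * scaling_coeffs \<phi> k)"

end

theory Submission
  imports Defs
begin

text \<open>
  Put \<open>c = 2 *\<^sub>R P\<close>. This is a lattice vector, and reflecting \<open>\<phi>\<close> to \<open>x \<mapsto> \<phi> (c - x)\<close>
  changes the transform to \<open>\<xi> \<mapsto> wchar \<xi> c * qft \<phi> (- \<xi>)\<close>, where \<open>wchar\<close> is the kernel of the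
  transform. The three statements are proved in a cycle.

  The symmetry (b) of the transform implies the symmetry (a) of \<open>\<phi>\<close> since the transform is
  injective on integrable functions of compact support (\<open>qft_injective\<close>, by Stone-Weierstrass).

  (a) implies (c): as \<open>\<phi>\<close> has compact support, the refinement equation of \<open>\<phi>\<close> is a finite sum
  whose coefficients are the inner products of the translates of \<open>\<phi>\<close> with its dilate. Reflecting the
  integrals shows that the coefficients are symmetric (\<open>filter_symmetric_if_symmetric\<close>).

  (c) implies (b): the transform of the refinement equation expresses the value at \<open>2 *\<^sub>R \<xi>\<close> of the
  transform by its value at \<open>\<xi>\<close>. Because quaternions do not commute, this is not multiplication by
  the filter, but a real-linear map built from \<open>m0 \<xi>\<close> and \<open>m0 (- \<xi>)\<close> (\<open>twisted_mult\<close>). When the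
  filter is symmetric, the reflected function satisfies the same equation (\<open>twisted_mult_wchar\<close>). The
  difference of the two transforms vanishes at the origin, to first order by compact support.
  Orthonormality of the translates forces \<open>norm (m0 0) \<le> 1\<close> (\<open>norm_scaling_filter_0\<close>), so each
  dilation by two near the origin multiplies the difference by a factor of at most \<open>3/2\<close>, which is too
  slow for a function of first order: the difference is zero (\<open>dilation_equation_zero\<close>).
\<close>

section \<open>Affine substitutions in Lebesgue integrals\<close>

lemma lebesgue_affine_scalar:
  fixes t :: "'a::euclidean_space"
  assumes "c \<noteq> 0"
  shows "lebesgue = density (distr lebesgue lebesgue (\<lambda>x. t + c *\<^sub>R x)) (\<lambda>_. ennreal (\<bar>c\<bar> ^ DIM('a)))"
    and "(\<lambda>x. t + c *\<^sub>R x) \<in> lebesgue \<rightarrow>\<^sub>M lebesgue"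
proof -
  have T: "(\<lambda>x. t + (\<Sum>j\<in>Basis. (c * (x \<bullet> j)) *\<^sub>R j)) = (\<lambda>x::'a. t + c *\<^sub>R x)"
    by (simp add: scaleR_scaleR[symmetric] scaleR_sum_right[symmetric] euclidean_representation
        del: scaleR_scaleR)
  show "lebesgue = density (distr lebesgue lebesgue (\<lambda>x. t + c *\<^sub>R x)) (\<lambda>_. ennreal (\<bar>c\<bar> ^ DIM('a)))"
    using lebesgue_affine_euclidean[of "\<lambda>_. c" t] assms by (simp add: T ennreal_power)
  show "(\<lambda>x. t + c *\<^sub>R x) \<in> lebesgue \<rightarrow>\<^sub>M lebesgue"
    using lebesgue_affine_measurable[of "\<lambda>_. c" t] assms by (simp add: T)
qed

lemma lebesgue_integral_affine:
  fixes f :: "'a::euclidean_space \<Rightarrow> 'b::euclidean_space"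
  assumes "c \<noteq> 0" and [measurable]: "f \<in> borel_measurable lebesgue"
  shows "(LINT x|lebesgue. f (t + c *\<^sub>R x)) = (1 / \<bar>c\<bar> ^ DIM('a)) *\<^sub>R (LINT x|lebesgue. f x)"
proof -
  note [measurable] = lebesgue_affine_scalar(2)[OF assms(1), of t]
  have "(LINT x|lebesgue. f x) = \<bar>c\<bar> ^ DIM('a) *\<^sub>R (LINT x|lebesgue. f (t + c *\<^sub>R x))"
    by (subst lebesgue_affine_scalar(1)[OF assms(1), of t])
       (simp add: integral_density integral_distr)
  then show ?thesis using assms(1) by simp
qed

lemma lebesgue_integrable_affine:
  fixes f :: "'a::euclidean_space \<Rightarrow> 'b::euclidean_space"
  assumes "c \<noteq> 0" and [measurable]: "f \<in> borel_measurable lebesgue"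
  shows "integrable lebesgue (\<lambda>x. f (t + c *\<^sub>R x)) \<longleftrightarrow> integrable lebesgue f"
proof -
  note [measurable] = lebesgue_affine_scalar(2)[OF assms(1), of t]
  have "integrable lebesgue f \<longleftrightarrow> integrable lebesgue (\<lambda>x. \<bar>c\<bar> ^ DIM('a) *\<^sub>R f (t + c *\<^sub>R x))"
    by (subst lebesgue_affine_scalar(1)[OF assms(1), of t])
       (simp add: integrable_density integrable_distr_eq)
  also have "\<dots> \<longleftrightarrow> integrable lebesgue (\<lambda>x. f (t + c *\<^sub>R x))"
    using assms(1) integrable_scaleR_right[of "inverse (\<bar>c\<bar> ^ DIM('a))" lebesgue
        "\<lambda>x. \<bar>c\<bar> ^ DIM('a) *\<^sub>R f (t + c *\<^sub>R x)"]
    by (intro iffI) auto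
  finally show ?thesis by simp
qed

lemma AE_lebesgue_affine:
  fixes t :: "'a::euclidean_space"
  assumes "c \<noteq> 0" and P: "AE x in lebesgue. P x"
  shows "AE x in lebesgue. P (t + c *\<^sub>R x)"
proof -
  note [measurable] = lebesgue_affine_scalar(2)[OF assms(1), of t]
  from P have "AE x in density (distr lebesgue lebesgue (\<lambda>x. t + c *\<^sub>R x)) (\<lambda>_. ennreal (\<bar>c\<bar> ^ DIM('a))). P x"
    by (subst (asm) lebesgue_affine_scalar(1)[OF assms(1), of t])
  then have "AE x in distr lebesgue lebesgue (\<lambda>x. t + c *\<^sub>R x). P x"
    using assms(1) by (subst (asm) AE_density) auto
  then show ?thesis by (rule AE_distrD[rotated]) measurable
qed

lemma measurable_lebesgue_affine:
  fixes t :: "'a::euclidean_space"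
  assumes "c \<noteq> 0" "f \<in> borel_measurable lebesgue"
  shows "(\<lambda>x. f (t + c *\<^sub>R x)) \<in> borel_measurable lebesgue"
  using measurable_compose[OF lebesgue_affine_scalar(2)[OF assms(1), of t] assms(2)] .

section \<open>Injectivity of the Fourier transform on compactly supported functions\<close>

text \<open>
  The span of the characters of a Euclidean space over the reals. Products are left out of the
  closure rules because the span is already closed under them; for the span it is then clear that
  orthogonality to all characters passes to every member.
\<close>

inductive trig_poly :: "('a::euclidean_space \<Rightarrow> real) \<Rightarrow> bool" where
  cos: "trig_poly (\<lambda>x. cos (t \<bullet> x))"
| sin: "trig_poly (\<lambda>x. sin (t \<bullet> x))"
| cmult: "trig_poly f \<Longrightarrow> trig_poly (\<lambda>x. c * f x)"
| add: "trig_poly f \<Longrightarrow> trig_poly g \<Longrightarrow> trig_poly (\<lambda>x. f x + g x)"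

lemma trig_poly_const: "trig_poly (\<lambda>x. c)"
  using trig_poly.cmult[OF trig_poly.cos[of 0], of c] by simp

text \<open>
  The product-to-sum formulas.
\<close>

lemma trig_poly_mult_cos_sin:
  assumes "trig_poly f"
  shows "trig_poly (\<lambda>x. cos (t \<bullet> x) * f x) \<and> trig_poly (\<lambda>x. sin (t \<bullet> x) * f x)"
  using assms
proof induction
  case (cos s)
  have "trig_poly (\<lambda>x. (1/2) * (cos ((t - s) \<bullet> x) + cos ((t + s) \<bullet> x)))"
    and "trig_poly (\<lambda>x. (1/2) * (sin ((t + s) \<bullet> x) + sin ((t - s) \<bullet> x)))"
    by (intro trig_poly.intros)+
  then show ?case
    by (simp add: inner_add_left inner_diff_left cos_add cos_diff sin_add sin_diff mult.commute)
next
  case (sin s)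
  have "trig_poly (\<lambda>x. (1/2) * (sin ((t + s) \<bullet> x) + (-1) * sin ((t - s) \<bullet> x)))"
    and "trig_poly (\<lambda>x. (1/2) * (cos ((t - s) \<bullet> x) + (-1) * cos ((t + s) \<bullet> x)))"
    by (intro trig_poly.intros)+
  then show ?case
    by (simp add: inner_add_left inner_diff_left cos_add cos_diff sin_add sin_diff mult.commute)
next
  case (cmult f c)
  then show ?case
    using trig_poly.cmult[of "\<lambda>x. cos (t \<bullet> x) * f x" c] trig_poly.cmult[of "\<lambda>x. sin (t \<bullet> x) * f x" c]
    by (simp add: mult.left_commute)
next
  case (add f g)
  then show ?case
    using trig_poly.add[of "\<lambda>x. cos (t \<bullet> x) * f x" "\<lambda>x. cos (t \<bullet> x) * g x"]
      trig_poly.add[of "\<lambda>x. sin (t \<bullet> x) * f x" "\<lambda>x. sin (t \<bullet> x) * g x"]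
    by (simp add: distrib_left)
qed

lemma trig_poly_mult:
  assumes "trig_poly f" "trig_poly g"
  shows "trig_poly (\<lambda>x. f x * g x)"
  using assms(1)
proof induction
  case (cmult f c)
  then show ?case using trig_poly.cmult[of "\<lambda>x. f x * g x" c] by (simp add: mult.assoc)
next
  case (add f h)
  then show ?case using trig_poly.add[of "\<lambda>x. f x * g x" "\<lambda>x. h x * g x"] by (simp add: distrib_right)
qed (use trig_poly_mult_cos_sin[OF assms(2)] in auto)

lemma trig_poly_continuous: "trig_poly f \<Longrightarrow> continuous_on S f"
  by (induction rule: trig_poly.induct) (auto intro!: continuous_intros)

text \<open>
  A frequency along \<open>x - y\<close> can be scaled so that the phases at the two points differ by \<open>\<pi>\<close>.
\<close>

lemma trig_poly_separates:
  assumes "x \<noteq> y"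
  shows "\<exists>f. trig_poly f \<and> f x \<noteq> f y"
proof -
  define t where "t = (pi / (norm (x - y))\<^sup>2) *\<^sub>R (x - y)"
  have "t \<bullet> (x - y) = pi"
    using assms by (simp add: t_def power2_norm_eq_inner)
  then have "cos (t \<bullet> (x - y)) = -1" by simp
  then have *: "cos (t \<bullet> x) * cos (t \<bullet> y) + sin (t \<bullet> x) * sin (t \<bullet> y) = -1"
    by (simp add: inner_diff_right cos_diff)
  have "\<not> (cos (t \<bullet> x) = cos (t \<bullet> y) \<and> sin (t \<bullet> x) = sin (t \<bullet> y))"
    using * sin_cos_squared_add3[of "t \<bullet> x"] by auto
  then show ?thesis using trig_poly.cos trig_poly.sin by metis
qed

lemma integrable_bounded_scaleR:
  fixes g :: "'a \<Rightarrow> 'b::{banach,second_countable_topology}"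
  assumes "integrable M g" "h \<in> borel_measurable M" "\<And>x. \<bar>h x\<bar> \<le> B"
  shows "integrable M (\<lambda>x. h x *\<^sub>R g x)"
proof (rule Bochner_Integration.integrable_bound[of M "\<lambda>x. B *\<^sub>R g x"])
  show "(\<lambda>x. h x *\<^sub>R g x) \<in> borel_measurable M" using assms by measurable
  have "norm (h x *\<^sub>R g x) \<le> norm (B *\<^sub>R g x)" for x
    using assms(3)[of x] by (auto intro!: mult_right_mono)
  then show "AE x in M. norm (h x *\<^sub>R g x) \<le> norm (B *\<^sub>R g x)" by simp
qed (use assms in simp)

lemma trig_poly_bounded: "trig_poly f \<Longrightarrow> \<exists>B. \<forall>x. \<bar>f x\<bar> \<le> B"
proof (induction rule: trig_poly.induct)
  case (cmult f c)
  then obtain B where "\<forall>x. \<bar>f x\<bar> \<le> B" by auto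
  then have "\<forall>x. \<bar>c * f x\<bar> \<le> \<bar>c\<bar> * B" by (auto simp: abs_mult intro!: mult_left_mono)
  then show ?case by blast
next
  case (add f g)
  then obtain B C where "\<forall>x. \<bar>f x\<bar> \<le> B" "\<forall>x. \<bar>g x\<bar> \<le> C" by auto
  then have "\<forall>x. \<bar>f x + g x\<bar> \<le> B + C" by (meson abs_triangle_ineq add_mono order_trans)
  then show ?case by blast
qed (use abs_cos_le_one abs_sin_le_one in blast)+

lemma borel_measurable_lebesgue_continuous:
  "continuous_on UNIV f \<Longrightarrow> f \<in> borel_measurable lebesgue"
  for f :: "'a::euclidean_space \<Rightarrow> 'b::euclidean_space"
  by (rule measurable_completion) (simp add: borel_measurable_continuous_onI)

lemma integral_trig_poly_eq_0:
  fixes g :: "'a::euclidean_space \<Rightarrow> 'b::euclidean_space"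
  assumes g: "integrable lebesgue g"
    and c: "\<And>t. (LINT x|lebesgue. cos (t \<bullet> x) *\<^sub>R g x) = 0"
    and s: "\<And>t. (LINT x|lebesgue. sin (t \<bullet> x) *\<^sub>R g x) = 0"
    and f: "trig_poly f"
  shows "(LINT x|lebesgue. f x *\<^sub>R g x) = 0"
  using f
proof (induction)
  case (cmult f k)
  then show ?case by (simp flip: scaleR_scaleR)
next
  case (add f h)
  have "integrable lebesgue (\<lambda>x. u x *\<^sub>R g x)" if "trig_poly u" for u
    using trig_poly_bounded[OF that] trig_poly_continuous[OF that, of UNIV]
    by (auto intro!: integrable_bounded_scaleR[OF g] borel_measurable_lebesgue_continuous)
  with add show ?case by (simp add: scaleR_add_left)
qed (use c s in auto)

text \<open>
  By the Stone-Weierstrass theorem trigonometric polynomials are uniformly dense on the compact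
  support of \<open>g\<close>, so a function orthogonal to all of them is orthogonal to every continuous function.
\<close>

lemma integral_continuous_eq_0:
  fixes g :: "'a::euclidean_space \<Rightarrow> 'b::euclidean_space"
  assumes g: "integrable lebesgue g"
    and supp: "compact S" "AE x in lebesgue. x \<notin> S \<longrightarrow> g x = 0"
    and c: "\<And>t. (LINT x|lebesgue. cos (t \<bullet> x) *\<^sub>R g x) = 0"
    and s: "\<And>t. (LINT x|lebesgue. sin (t \<bullet> x) *\<^sub>R g x) = 0"
    and h: "continuous_on UNIV h" and hB: "\<And>x. \<bar>h x\<bar> \<le> B"
  shows "(LINT x|lebesgue. h x *\<^sub>R g x) = 0"
proof -
  have le: "norm (LINT x|lebesgue. h x *\<^sub>R g x) \<le> e * (LINT x|lebesgue. norm (g x))" if "e > 0" for e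
  proof -
    have "\<exists>f. trig_poly f \<and> (\<forall>x\<in>S. \<bar>h x - f x\<bar> < e)"
      using trig_poly_separates
      by (intro Stone_Weierstrass_HOL)
         (auto intro: supp that trig_poly_const trig_poly_continuous trig_poly.add trig_poly_mult
            continuous_on_subset[OF h])
    then obtain f where f: "trig_poly f" "\<And>x. x \<in> S \<Longrightarrow> \<bar>h x - f x\<bar> < e" by auto
    obtain C where C: "\<And>x. \<bar>f x\<bar> \<le> C" using trig_poly_bounded[OF f(1)] by auto
    have i: "integrable lebesgue (\<lambda>x. h x *\<^sub>R g x)" "integrable lebesgue (\<lambda>x. f x *\<^sub>R g x)"
      using g h hB C trig_poly_continuous[OF f(1)]
      by (auto intro!: integrable_bounded_scaleR borel_measurable_lebesgue_continuous)
    have "norm (LINT x|lebesgue. h x *\<^sub>R g x) = norm (LINT x|lebesgue. (h x - f x) *\<^sub>R g x)"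
      using i integral_trig_poly_eq_0[OF g c s f(1)] by (simp add: scaleR_diff_left)
    also have "\<dots> \<le> (LINT x|lebesgue. norm ((h x - f x) *\<^sub>R g x))"
      by (rule integral_norm_bound)
    also have "\<dots> \<le> (LINT x|lebesgue. e * norm (g x))"
    proof (rule integral_mono_AE)
      show "integrable lebesgue (\<lambda>x. norm ((h x - f x) *\<^sub>R g x))"
        using i by (intro integrable_norm) (simp add: scaleR_diff_left)
      show "AE x in lebesgue. norm ((h x - f x) *\<^sub>R g x) \<le> e * norm (g x)"
        using supp(2) by eventually_elim (use f(2) in \<open>force intro: mult_right_mono\<close>)
    qed (use g in auto)
    finally show ?thesis by simp
  qed
  have "norm (LINT x|lebesgue. h x *\<^sub>R g x) \<le> 0 + e" if "e > 0" for e
  proof -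
    define I where "I = (LINT x|lebesgue. norm (g x))"
    have "I \<ge> 0" unfolding I_def by simp
    then have "e / (I + 1) * I \<le> e" using that by (simp add: field_simps)
    with le[of "e / (I + 1)"] \<open>I \<ge> 0\<close> that show ?thesis unfolding I_def[symmetric] by simp
  qed
  then have "norm (LINT x|lebesgue. h x *\<^sub>R g x) \<le> 0" by (rule field_le_epsilon)
  then show ?thesis by simp
qed

text \<open>
  For a basis vector \<open>b\<close>, the measurable function \<open>sgn (g x \<bullet> b)\<close> is an almost-everywhere limit of
  continuous functions. Testing \<open>g\<close> against these and passing to the limit gives that \<open>\<bar>g \<bullet> b\<bar>\<close> has
  integral zero.
\<close>

lemma Fourier_injective:
  fixes g :: "'a::euclidean_space \<Rightarrow> 'b::euclidean_space"
  assumes g: "integrable lebesgue g"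
    and supp: "compact S" "AE x in lebesgue. x \<notin> S \<longrightarrow> g x = 0"
    and c: "\<And>t. (LINT x|lebesgue. cos (t \<bullet> x) *\<^sub>R g x) = 0"
    and s: "\<And>t. (LINT x|lebesgue. sin (t \<bullet> x) *\<^sub>R g x) = 0"
  shows "AE x in lebesgue. g x = 0"
proof -
  have gm[measurable]: "g \<in> borel_measurable lebesgue" using g by auto
  have "AE x in lebesgue. g x \<bullet> b = 0" if "b \<in> Basis" for b
  proof -
    have "(\<lambda>x. sgn (g x \<bullet> b)) \<in> borel_measurable lebesgue" by measurable
    then have "(\<lambda>x. sgn (g x \<bullet> b)) measurable_on UNIV"
      by (intro lebesgue_measurable_imp_measurable_on) auto
    then obtain N h where N: "negligible N" and h: "\<And>n::nat. continuous_on UNIV (h n)"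
      and lim: "\<And>x. x \<notin> N \<Longrightarrow> (\<lambda>n. h n x) \<longlonglongrightarrow> sgn (g x \<bullet> b)"
      unfolding measurable_on_def by auto
    \<comment> \<open>Clamping keeps the limit, since the signs lie in the interval, and provides domination.\<close>
    define k where "k n x = max (-1) (min 1 (h n x))" for n x
    have k: "continuous_on UNIV (k n)" "\<bar>k n x\<bar> \<le> 1" for n x
      unfolding k_def using h by (auto intro!: continuous_intros)
    have klim: "(\<lambda>n. k n x) \<longlonglongrightarrow> sgn (g x \<bullet> b)" if "x \<notin> N" for x
    proof -
      have "(\<lambda>n. k n x) \<longlonglongrightarrow> max (-1) (min 1 (sgn (g x \<bullet> b)))"
        unfolding k_def by (intro tendsto_intros lim that)
      then show ?thesis by (simp add: sgn_real_def split: if_splits)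
    qed
    have km[measurable]: "k n \<in> borel_measurable lebesgue" for n
      using k(1) by (rule borel_measurable_lebesgue_continuous)
    have 0: "(LINT x|lebesgue. k n x *\<^sub>R g x) = 0" for n
      by (rule integral_continuous_eq_0[OF g supp c s k])
    have "(\<lambda>n. LINT x|lebesgue. k n x *\<^sub>R g x) \<longlonglongrightarrow> (LINT x|lebesgue. sgn (g x \<bullet> b) *\<^sub>R g x)"
    proof (rule integral_dominated_convergence)
      have "AE x in lebesgue. x \<notin> N"
        using N by (simp add: negligible_iff_null_sets AE_not_in)
      then show "AE x in lebesgue. (\<lambda>n. k n x *\<^sub>R g x) \<longlonglongrightarrow> sgn (g x \<bullet> b) *\<^sub>R g x"
        by eventually_elim (intro tendsto_intros klim)
      show "AE x in lebesgue. norm (k n x *\<^sub>R g x) \<le> norm (g x)" for n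
        using k(2)[of n] by (auto intro!: mult_left_le_one_le)
    qed (use g in \<open>measurable; simp\<close>)+
    then have "(LINT x|lebesgue. sgn (g x \<bullet> b) *\<^sub>R g x) = 0"
      using 0 by (simp add: LIMSEQ_const_iff)
    moreover have int: "integrable lebesgue (\<lambda>x. sgn (g x \<bullet> b) *\<^sub>R g x)"
      by (rule integrable_bounded_scaleR[OF g, of _ 1]) (auto simp: sgn_real_def)
    ultimately have "(LINT x|lebesgue. (sgn (g x \<bullet> b) *\<^sub>R g x) \<bullet> b) = 0"
      by (simp only: integral_inner_left inner_zero_left)
    moreover have "(sgn (g x \<bullet> b) *\<^sub>R g x) \<bullet> b = \<bar>g x \<bullet> b\<bar>" for x
      by (simp add: sgn_mult_abs mult.commute abs_sgn)
    ultimately have "(LINT x|lebesgue. \<bar>g x \<bullet> b\<bar>) = 0" by simp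
    moreover have "integrable lebesgue (\<lambda>x. \<bar>g x \<bullet> b\<bar>)" using g by auto
    ultimately have "AE x in lebesgue. \<bar>g x \<bullet> b\<bar> = 0"
      by (subst (asm) integral_nonneg_eq_0_iff_AE) auto
    then show ?thesis by simp
  qed
  then have "AE x in lebesgue. \<forall>b\<in>Basis. g x \<bullet> b = 0" by (intro AE_finite_allI) auto
  then show ?thesis by eventually_elim (auto simp: euclidean_eq_iff[where 'a='b])
qed

section \<open>Quaternion arithmetic\<close>

lemma quat_times_sel [simp]:
  "qre (x * y) = qre x * qre y - qe1 x * qe1 y - qe2 x * qe2 y - qe12 x * qe12 y"
  "qe1 (x * y) = qre x * qe1 y + qe1 x * qre y + qe2 x * qe12 y - qe12 x * qe2 y"
  "qe2 (x * y) = qre x * qe2 y - qe1 x * qe12 y + qe2 x * qre y + qe12 x * qe1 y"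
  "qe12 (x * y) = qre x * qe12 y + qe1 x * qe2 y - qe2 x * qe1 y + qe12 x * qre y"
  by (simp_all add: times_quat_def)

lemma quat_scaleR_sel [simp]:
  "qre (r *\<^sub>R x) = r * qre x" "qe1 (r *\<^sub>R x) = r * qe1 x"
  "qe2 (r *\<^sub>R x) = r * qe2 x" "qe12 (r *\<^sub>R x) = r * qe12 x"
  by (simp_all add: scaleR_quat_def)

lemma quat_cnj_sel [simp]:
  "qre (quat_cnj x) = qre x" "qe1 (quat_cnj x) = - qe1 x"
  "qe2 (quat_cnj x) = - qe2 x" "qe12 (quat_cnj x) = - qe12 x"
  by (simp_all add: quat_cnj_def)

lemma quat_e12_sel [simp]: "qre e12 = 0" "qe1 e12 = 0" "qe2 e12 = 0" "qe12 e12 = 1"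
  by (simp_all add: e12_def)

lemma norm_quat_sq: "(norm x)\<^sup>2 = (qre x)\<^sup>2 + (qe1 x)\<^sup>2 + (qe2 x)\<^sup>2 + (qe12 x)\<^sup>2" for x :: quat
  by (simp add: norm_quat_def)

text \<open>
  Euler's four-square identity.
\<close>

lemma norm_quat_mult: "norm (x * y) = norm x * norm y" for x y :: quat
proof -
  have "(norm (x * y))\<^sup>2 = (norm x * norm y)\<^sup>2"
    by (simp add: power_mult_distrib norm_quat_sq) (simp add: power2_eq_square algebra_simps)
  then show ?thesis by (simp add: power2_eq_iff_nonneg)
qed

lemma quat_cnj_mult: "quat_cnj (x * y) = quat_cnj y * quat_cnj x"
  by (simp add: quat_eq_iff algebra_simps)

lemma quat_cnj_cnj [simp]: "quat_cnj (quat_cnj x) = x"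
  by (simp add: quat_eq_iff)

lemma quat_cnj_0_1 [simp]: "quat_cnj 0 = 0" "quat_cnj 1 = 1"
  by (simp_all add: quat_eq_iff)

lemma norm_quat_cnj [simp]: "norm (quat_cnj x) = norm x"
  by (simp add: norm_quat_def)

lemma quat_cnj_mult_self: "quat_cnj x * x = of_real ((norm x)\<^sup>2)"
  by (simp add: quat_eq_iff of_real_def norm_quat_sq) (simp add: power2_eq_square algebra_simps)

lemma bounded_linear_quat_cnj: "bounded_linear quat_cnj"
  by (rule bounded_linear_intro[where K = 1]) (simp_all add: quat_eq_iff)

lemma bounded_linear_qre: "bounded_linear qre"
proof (rule bounded_linear_intro[where K = 1])
  show "norm (qre x) \<le> norm x * 1" for x
    by (simp add: norm_quat_def real_le_rsqrt)
qed auto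

lemma quat_cnj_sum: "quat_cnj (sum f A) = (\<Sum>k\<in>A. quat_cnj (f k))"
  by (rule linear_sum[OF bounded_linear.linear[OF bounded_linear_quat_cnj]])

text \<open>
  The complex exponential is carried over by the continuous embedding \<open>h\<close> of the complex numbers
  that sends the imaginary unit to \<^term>\<open>e12\<close>.
\<close>

lemma exp_e12: "exp (t *\<^sub>R e12) = Quat (cos t) 0 0 (sin t)"
proof -
  define h where "h z = Quat (Re z) 0 0 (Im z)" for z
  have hb: "bounded_linear h"
    by (rule bounded_linear_intro[where K = 1])
       (simp_all add: h_def quat_eq_iff norm_quat_def cmod_def)
  have hm: "h (z * w) = h z * h w" for z w by (simp add: h_def quat_eq_iff)
  have h1: "h 1 = 1" by (simp add: h_def quat_eq_iff)
  have hp: "h (z ^ n) = h z ^ n" for z n by (induction n) (simp_all add: hm h1)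
  have "(\<lambda>n. h ((\<i> * of_real t) ^ n /\<^sub>R fact n)) sums h (exp (\<i> * of_real t))"
    by (intro bounded_linear.sums[OF hb] exp_converges)
  then have "(\<lambda>n. h (\<i> * of_real t) ^ n /\<^sub>R fact n) sums h (exp (\<i> * of_real t))"
    by (simp add: linear_scale[OF bounded_linear.linear[OF hb]] hp)
  with exp_converges[of "h (\<i> * of_real t)"] have "exp (h (\<i> * of_real t)) = h (exp (\<i> * of_real t))"
    by (rule sums_unique2)
  moreover have "h (\<i> * of_real t) = t *\<^sub>R e12" by (simp add: h_def quat_eq_iff)
  moreover have "h (exp (\<i> * of_real t)) = Quat (cos t) 0 0 (sin t)"
    by (simp add: h_def exp_Euler cos_of_real sin_of_real)
  ultimately show ?thesis by simp
qed

section \<open>The quaternionic characters of the plane\<close>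

definition wchar :: "real^2 \<Rightarrow> real^2 \<Rightarrow> quat" where
  "wchar \<xi> x = exp ((2 * pi) *\<^sub>R (\<xi> \<^bold>\<and> x))"

lemma wchar_eq:
  "wchar \<xi> x = Quat (cos (2 * pi * (\<xi>$1 * x$2 - \<xi>$2 * x$1))) 0 0 (sin (2 * pi * (\<xi>$1 * x$2 - \<xi>$2 * x$1)))"
  by (simp add: wchar_def wedge_def exp_e12)

lemma wchar_cos_sin:
  "wchar \<xi> x = cos (2 * pi * (\<xi>$1 * x$2 - \<xi>$2 * x$1)) *\<^sub>R 1 + sin (2 * pi * (\<xi>$1 * x$2 - \<xi>$2 * x$1)) *\<^sub>R e12"
  by (simp add: wchar_eq quat_eq_iff)

lemma wchar_add: "wchar \<xi> (x + y) = wchar \<xi> x * wchar \<xi> y"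
proof -
  have *: "2 * pi * (\<xi>$1 * (x + y)$2 - \<xi>$2 * (x + y)$1) =
     2 * pi * (\<xi>$1 * x$2 - \<xi>$2 * x$1) + 2 * pi * (\<xi>$1 * y$2 - \<xi>$2 * y$1)"
    by (simp add: algebra_simps)
  show ?thesis unfolding wchar_eq * by (simp add: quat_eq_iff cos_add sin_add)
qed

lemma wchar_uminus: "wchar (- \<xi>) x = wchar \<xi> (- x)"
  by (simp add: wchar_eq)

lemma wchar_minus: "wchar (- \<xi>) x = quat_cnj (wchar \<xi> x)"
proof -
  have "2 * pi * ((- \<xi>)$1 * x$2 - (- \<xi>)$2 * x$1) = - (2 * pi * (\<xi>$1 * x$2 - \<xi>$2 * x$1))"
    by (simp add: algebra_simps)
  then show ?thesis unfolding wchar_eq by (simp only: cos_minus sin_minus) (simp add: quat_eq_iff)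
qed

lemma wchar_0 [simp]: "wchar 0 x = 1" "wchar \<xi> 0 = 1"
  by (simp_all add: wchar_eq quat_eq_iff)

lemma wchar_scaleR: "wchar (r *\<^sub>R \<xi>) x = wchar \<xi> (r *\<^sub>R x)"
  by (simp add: wchar_eq algebra_simps)

lemma norm_wchar [simp]: "norm (wchar \<xi> x) = 1"
  by (simp add: wchar_eq norm_quat_def)

text \<open>
  A chord of the unit circle is at most as long as its arc.
\<close>

lemma norm_wchar_minus_1: "norm (wchar \<xi> x - 1) \<le> 4 * pi * norm \<xi> * norm x"
proof -
  define w where "w = \<xi>$1 * x$2 - \<xi>$2 * x$1"
  define t where "t = 2 * pi * w"
  have "(norm (wchar \<xi> x - 1))\<^sup>2 = (cos t - 1)\<^sup>2 + (sin t)\<^sup>2"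
    by (simp add: wchar_eq norm_quat_sq w_def t_def)
  also have "\<dots> = 2 - 2 * cos (2 * (t / 2))"
    using sin_cos_squared_add[of t] by (simp add: power2_eq_square algebra_simps)
  also have "\<dots> = (2 * sin (t / 2))\<^sup>2"
    unfolding cos_double_sin by (simp add: power_mult_distrib)
  also have "\<dots> \<le> (2 * (t / 2))\<^sup>2"
    unfolding abs_le_square_iff[symmetric] using abs_sin_x_le_abs_x[of "t / 2"] by (simp add: abs_mult)
  finally have "norm (wchar \<xi> x - 1) \<le> \<bar>t\<bar>"
    by (simp add: abs_le_square_iff[symmetric])
  moreover have "\<bar>w\<bar> \<le> \<bar>\<xi>$1\<bar> * \<bar>x$2\<bar> + \<bar>\<xi>$2\<bar> * \<bar>x$1\<bar>"
    unfolding w_def abs_mult[symmetric] by linarith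
  moreover have "\<bar>\<xi>$1\<bar> * \<bar>x$2\<bar> + \<bar>\<xi>$2\<bar> * \<bar>x$1\<bar> \<le> norm \<xi> * norm x + norm \<xi> * norm x"
    by (intro add_mono mult_mono component_le_norm_cart) auto
  ultimately have "norm (wchar \<xi> x - 1) \<le> 2 * pi * \<bar>w\<bar>" "\<bar>w\<bar> \<le> 2 * (norm \<xi> * norm x)"
    by (auto simp: t_def abs_mult)
  then have "norm (wchar \<xi> x - 1) \<le> 2 * pi * (2 * (norm \<xi> * norm x))"
    by (smt (verit) mult_left_mono pi_ge_zero)
  then show ?thesis by (simp add: mult_ac)
qed

section \<open>The dilation equation in frequency space\<close>

text \<open>
  A quaternion is a sum of a part commuting with \<^term>\<open>e12\<close> and a part anticommuting with it. Moving a
  character from the left to the right of the second part turns \<open>\<xi>\<close> into \<open>- \<xi>\<close>.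
\<close>

definition cpart :: "quat \<Rightarrow> quat" where "cpart q = Quat (qre q) 0 0 (qe12 q)"
definition jpart :: "quat \<Rightarrow> quat" where "jpart q = Quat 0 (qe1 q) (qe2 q) 0"

lemma cpart_jpart: "cpart q + jpart q = q"
  by (simp add: cpart_def jpart_def quat_eq_iff)

lemma cpart_jpart_diff: "cpart (p - q) = cpart p - cpart q" "jpart (p - q) = jpart p - jpart q"
  by (simp_all add: cpart_def jpart_def quat_eq_iff)

lemma norm_cpart: "norm (cpart q) \<le> norm q" and norm_jpart: "norm (jpart q) \<le> norm q"
  by (simp_all add: cpart_def jpart_def norm_quat_def)

lemma wchar_mult_cpart: "wchar \<xi> x * cpart q = cpart q * wchar \<xi> x"
  by (simp add: wchar_eq cpart_def quat_eq_iff)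

lemma wchar_mult_jpart: "wchar \<xi> x * jpart q = jpart q * wchar (- \<xi>) x"
  unfolding wchar_minus by (simp add: wchar_eq jpart_def quat_eq_iff)

lemma cpart_wchar_mult: "cpart (wchar \<xi> x * q) = wchar \<xi> x * cpart q"
  and jpart_wchar_mult: "jpart (wchar \<xi> x * q) = wchar \<xi> x * jpart q"
  by (simp_all add: wchar_eq cpart_def jpart_def quat_eq_iff)

text \<open>
  In the transformed refinement equation the characters stand to the left and the coefficients to
  the right of the transform of the scaling function. Because quaternions do not commute, the
  resulting map is not multiplication by the filter \<open>m\<close> but this combination of its values at
  \<open>\<xi>\<close> and \<open>- \<xi>\<close>.
\<close>

definition twisted_mult :: "(real^2 \<Rightarrow> quat) \<Rightarrow> real^2 \<Rightarrow> quat \<Rightarrow> quat" where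
  "twisted_mult m \<xi> q = cpart q * m \<xi> + jpart q * m (- \<xi>)"

lemma twisted_mult_eq_sum:
  assumes "\<And>\<xi>. m \<xi> = (\<Sum>k\<in>A. wchar \<xi> (p k) * a k)"
  shows "twisted_mult m \<xi> q = (\<Sum>k\<in>A. wchar \<xi> (p k) * q * a k)"
proof -
  have "wchar \<xi> (p k) * q * a k = cpart q * (wchar \<xi> (p k) * a k) + jpart q * (wchar (- \<xi>) (p k) * a k)" for k
  proof -
    have "wchar \<xi> (p k) * q = wchar \<xi> (p k) * cpart q + wchar \<xi> (p k) * jpart q"
      by (simp add: cpart_jpart flip: distrib_left)
    then show ?thesis
      by (simp add: wchar_mult_cpart wchar_mult_jpart distrib_right mult.assoc)
  qed
  then show ?thesis
    by (simp add: twisted_mult_def assms sum_distrib_left sum.distrib)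
qed

lemma twisted_mult_diff: "twisted_mult m \<xi> (p - q) = twisted_mult m \<xi> p - twisted_mult m \<xi> q"
  by (simp add: twisted_mult_def cpart_jpart_diff algebra_simps)

text \<open>
  If the filter is symmetric, reflecting a function in space maps solutions of the dilation
  equation to solutions. The commuting part picks up the second factor \<open>wchar \<xi> c\<close> from
  \<open>m \<xi> = wchar \<xi> c * m (- \<xi>)\<close>; in the anticommuting part the symmetry at \<open>- \<xi>\<close>
  gives the inverse factor, which is inverted again when moved to the left.
\<close>

lemma twisted_mult_wchar:
  assumes "\<And>\<xi>. m \<xi> = wchar \<xi> c * m (- \<xi>)"
  shows "twisted_mult m \<xi> (wchar \<xi> c * q) = wchar (2 *\<^sub>R \<xi>) c * twisted_mult m (- \<xi>) q"
proof -
  have 2: "wchar (2 *\<^sub>R \<xi>) c = wchar \<xi> c * wchar \<xi> c"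
    unfolding wchar_scaleR wchar_add[symmetric] by (simp add: scaleR_2)
  have a: "wchar \<xi> c * cpart q * m \<xi> = wchar \<xi> c * wchar \<xi> c * cpart q * m (- \<xi>)"
  proof -
    have "wchar \<xi> c * cpart q * m \<xi> = wchar \<xi> c * (cpart q * wchar \<xi> c) * m (- \<xi>)"
      using assms[of \<xi>] by (simp add: mult.assoc)
    then show ?thesis by (simp add: wchar_mult_cpart[symmetric] mult.assoc)
  qed
  have b: "wchar \<xi> c * jpart q * m (- \<xi>) = wchar \<xi> c * wchar \<xi> c * jpart q * m \<xi>"
  proof -
    have "wchar \<xi> c * jpart q * m (- \<xi>) = wchar \<xi> c * (jpart q * wchar (- \<xi>) c) * m \<xi>"
      using assms[of "- \<xi>"] by (simp add: mult.assoc)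
    then show ?thesis by (simp add: wchar_mult_jpart[symmetric] mult.assoc)
  qed
  show ?thesis
    unfolding twisted_mult_def cpart_wchar_mult jpart_wchar_mult a b 2
    by (simp add: distrib_left mult.assoc)
qed

lemma norm_twisted_mult_le:
  "norm (twisted_mult m \<xi> q) \<le> (norm (m 0) + norm (m \<xi> - m 0) + norm (m (- \<xi>) - m 0)) * norm q"
proof -
  have "twisted_mult m \<xi> q = q * m 0 + cpart q * (m \<xi> - m 0) + jpart q * (m (- \<xi>) - m 0)"
    by (subst (2) cpart_jpart[symmetric]) (simp add: twisted_mult_def algebra_simps)
  also have "norm \<dots> \<le> norm q * norm (m 0) + norm (cpart q) * norm (m \<xi> - m 0)
      + norm (jpart q) * norm (m (- \<xi>) - m 0)"
    by (intro norm_triangle_le add_mono) (simp_all add: norm_quat_mult)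
  also have "\<dots> \<le> norm q * norm (m 0) + norm q * norm (m \<xi> - m 0) + norm q * norm (m (- \<xi>) - m 0)"
    by (intro add_mono mult_right_mono norm_cpart norm_jpart) auto
  finally show ?thesis by (simp add: algebra_simps)
qed

text \<open>
  Iterating the equation inwards, \<open>n\<close> halvings of \<open>\<xi>\<close> cost at most a factor \<open>(3/2)^n\<close> near the
  origin, where the twisted multiplication has norm at most \<open>3/2\<close> by continuity, but the linear
  bound gains \<open>(1/2)^n\<close>. So
  \<open>d\<close> vanishes near the origin, and the equation spreads this to the whole plane.
\<close>

lemma dilation_equation_zero:
  fixes d :: "real^2 \<Rightarrow> quat"
  assumes eq: "\<And>\<xi>. d (2 *\<^sub>R \<xi>) = twisted_mult m \<xi> (d \<xi>)"
    and lip: "\<And>\<xi>. norm (d \<xi>) \<le> C * norm \<xi>"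
    and m: "continuous (at 0) m" "norm (m 0) \<le> 1"
  shows "d \<xi> = 0"
proof -
  obtain r where r: "r > 0" "\<And>\<xi>. norm \<xi> < r \<Longrightarrow> norm (m \<xi> - m 0) < 1/4"
    using m(1)[unfolded continuous_at_eps_delta, rule_format, of "1/4"] by (auto simp: dist_norm)
  have step: "norm (d (2 *\<^sub>R \<xi>)) \<le> 3/2 * norm (d \<xi>)" if "norm \<xi> < r" for \<xi>
  proof -
    have "norm (m 0) + norm (m \<xi> - m 0) + norm (m (- \<xi>) - m 0) \<le> 3/2"
      using r(2)[of \<xi>] r(2)[of "- \<xi>"] m(2) that by simp
    then show ?thesis
      unfolding eq by (intro order_trans[OF norm_twisted_mult_le] mult_right_mono) auto
  qed
  have small: "d \<xi> = 0" if "norm \<xi> < r" for \<xi>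
  proof -
    have *: "norm (d \<xi>) \<le> (3/2)^n * norm (d ((1/2)^n *\<^sub>R \<xi>))" for n
    proof (induction n)
      case (Suc n)
      have "norm ((1/2)^Suc n *\<^sub>R \<xi>) \<le> 1 * norm \<xi>"
        unfolding norm_scaleR using power_le_one[of "1/2::real" "Suc n"]
        by (intro mult_right_mono) auto
      then have "norm (d (2 *\<^sub>R ((1/2)^Suc n *\<^sub>R \<xi>))) \<le> 3/2 * norm (d ((1/2)^Suc n *\<^sub>R \<xi>))"
        using that by (intro step) simp
      then have "norm (d ((1/2)^n *\<^sub>R \<xi>)) \<le> 3/2 * norm (d ((1/2)^Suc n *\<^sub>R \<xi>))" by simp
      then have "(3/2)^n * norm (d ((1/2)^n *\<^sub>R \<xi>)) \<le> (3/2)^n * (3/2 * norm (d ((1/2)^Suc n *\<^sub>R \<xi>)))"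
        by (intro mult_left_mono) auto
      with Suc show ?case unfolding power_Suc2[of "3/2"] mult.assoc by (rule order_trans)
    qed simp
    have "norm (d \<xi>) \<le> C * norm \<xi> * (3/4)^n" for n
    proof -
      have "norm (d \<xi>) \<le> (3/2)^n * (C * norm ((1/2)^n *\<^sub>R \<xi>))"
        using *[of n] lip[of "(1/2)^n *\<^sub>R \<xi>"] by (meson mult_left_mono order_trans zero_le_power zero_le_divide_iff zero_le_numeral)
      also have "\<dots> = C * norm \<xi> * ((3/2)^n * (1/2)^n)" by (simp add: mult_ac)
      also have "(3/2)^n * (1/2)^n = (3/4::real)^n" by (simp flip: power_mult_distrib)
      finally show ?thesis .
    qed
    moreover have "(\<lambda>n. C * norm \<xi> * (3/4)^n) \<longlonglongrightarrow> C * norm \<xi> * 0"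
      by (intro tendsto_intros LIMSEQ_realpow_zero) auto
    ultimately have "norm (d \<xi>) \<le> C * norm \<xi> * 0" by (intro LIMSEQ_le_const) auto
    then show ?thesis by simp
  qed
  have "d (2 ^ n *\<^sub>R \<zeta>) = 0" if "norm \<zeta> < r" for n \<zeta>
  proof (induction n)
    case (Suc n)
    have "d (2 ^ Suc n *\<^sub>R \<zeta>) = twisted_mult m (2 ^ n *\<^sub>R \<zeta>) (d (2 ^ n *\<^sub>R \<zeta>))"
      by (simp flip: eq)
    then show ?case by (simp add: Suc twisted_mult_def cpart_def jpart_def quat_eq_iff)
  qed (simp add: small that)
  moreover obtain n where "norm \<xi> / r < 2 ^ n"
    using real_arch_pow[of 2 "norm \<xi> / r"] by auto
  then have "norm ((1/2)^n *\<^sub>R \<xi>) < r"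
    using r(1) by (simp add: field_simps power_divide)
  ultimately have "d (2 ^ n *\<^sub>R ((1/2)^n *\<^sub>R \<xi>)) = 0" by blast
  then show ?thesis by (simp add: power_divide)
qed

section \<open>Inner products and orthonormal families of quaternion-valued functions\<close>

lemma measurable_quat_cnj [measurable]:
  "f \<in> borel_measurable M \<Longrightarrow> (\<lambda>x. quat_cnj (f x)) \<in> borel_measurable M"
  by (rule measurable_compose[where N = borel])
     (auto intro: borel_measurable_continuous_onI linear_continuous_on bounded_linear_quat_cnj)

lemma L2D:
  assumes "f \<in> L2"
  shows "f \<in> borel_measurable lebesgue" "integrable lebesgue (\<lambda>x. (norm (f x))\<^sup>2)"
  using assms by (auto simp: L2_def)

text \<open>
  Twice a product of two norms is at most the sum of their squares.
\<close>

lemma L2_integrable_cnj_mult: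
  assumes "f \<in> L2" "g \<in> L2"
  shows "integrable lebesgue (\<lambda>x. quat_cnj (f x) * g x)"
proof (rule Bochner_Integration.integrable_bound)
  note [measurable] = L2D(1)[OF assms(1)] L2D(1)[OF assms(2)]
  show "integrable lebesgue (\<lambda>x. (norm (f x))\<^sup>2 + (norm (g x))\<^sup>2)"
    using assms by (auto intro!: L2D)
  show "(\<lambda>x. quat_cnj (f x) * g x) \<in> borel_measurable lebesgue" by measurable
  have "norm (quat_cnj p * q) \<le> norm ((norm p)\<^sup>2 + (norm q)\<^sup>2)" for p q :: quat
    using sum_squares_bound[of "norm p" "norm q"] mult_nonneg_nonneg[OF norm_ge_zero norm_ge_zero, of p q]
    unfolding norm_quat_mult norm_quat_cnj real_norm_def by linarith
  then show "AE x in lebesgue. norm (quat_cnj (f x) * g x) \<le> norm ((norm (f x))\<^sup>2 + (norm (g x))\<^sup>2)"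
    by blast
qed

lemma L2_mult_right:
  assumes "f \<in> L2"
  shows "(\<lambda>x. f x * c) \<in> L2"
  unfolding L2_def using L2D[OF assms] by (auto simp: norm_quat_mult power_mult_distrib)

lemma L2_add:
  assumes "f \<in> L2" "g \<in> L2"
  shows "(\<lambda>x. f x + g x) \<in> L2"
proof -
  note [measurable] = L2D(1)[OF assms(1)] L2D(1)[OF assms(2)]
  have "integrable lebesgue (\<lambda>x. (norm (f x + g x))\<^sup>2)"
  proof (rule Bochner_Integration.integrable_bound)
    show "integrable lebesgue (\<lambda>x. 2 * (norm (f x))\<^sup>2 + 2 * (norm (g x))\<^sup>2)"
      using assms by (auto intro!: L2D)
    have "(norm (p + q))\<^sup>2 \<le> 2 * (norm p)\<^sup>2 + 2 * (norm q)\<^sup>2" for p q :: quat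
    proof -
      have "(norm (p + q))\<^sup>2 \<le> (norm p + norm q)\<^sup>2"
        by (intro power_mono norm_triangle_ineq) auto
      also have "\<dots> \<le> 2 * (norm p)\<^sup>2 + 2 * (norm q)\<^sup>2"
        using sum_squares_bound[of "norm p" "norm q"] by (simp add: power2_sum)
      finally show ?thesis .
    qed
    then show "AE x in lebesgue. norm ((norm (f x + g x))\<^sup>2) \<le> norm (2 * (norm (f x))\<^sup>2 + 2 * (norm (g x))\<^sup>2)"
      by simp
  qed measurable
  then show ?thesis by (simp add: L2_def)
qed

lemma L2_sum:
  assumes "\<And>k. b k \<in> L2"
  shows "(\<lambda>x. \<Sum>k\<in>A. b k x * c k) \<in> L2"
proof (induction A rule: infinite_finite_induct)
  case (insert k A)
  then show ?case using L2_add[OF L2_mult_right[OF assms]] by simp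
qed (simp_all add: L2_def)

lemma L2_diff:
  assumes "f \<in> L2" "g \<in> L2"
  shows "(\<lambda>x. f x - g x) \<in> L2"
  using L2_add[OF assms(1) L2_mult_right[OF assms(2), of "-1"]] by simp

lemma L2_affine:
  assumes "f \<in> L2" "c \<noteq> 0"
  shows "(\<lambda>x. f (t + c *\<^sub>R x)) \<in> L2"
  using L2D[OF assms(1)] assms(2)
    lebesgue_integrable_affine[OF assms(2), of "\<lambda>x. (norm (f x))\<^sup>2" t]
  by (auto simp: L2_def intro: measurable_lebesgue_affine)

lemma L2_inner_cnj:
  assumes "f \<in> L2" "g \<in> L2"
  shows "L2_inner g f = quat_cnj (L2_inner f g)"
  using integral_bounded_linear[OF bounded_linear_quat_cnj L2_integrable_cnj_mult[OF assms]]
  by (simp add: L2_inner_def quat_cnj_mult)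

lemma L2_inner_sum_right:
  assumes "f \<in> L2" "\<And>k. b k \<in> L2"
  shows "L2_inner f (\<lambda>x. \<Sum>k\<in>A. b k x * c k) = (\<Sum>k\<in>A. L2_inner f (b k) * c k)"
  using L2_integrable_cnj_mult[OF assms]
  by (simp add: L2_inner_def sum_distrib_left flip: mult.assoc)

lemma L2_inner_diff_right:
  assumes "f \<in> L2" "g \<in> L2" "h \<in> L2"
  shows "L2_inner f (\<lambda>x. g x - h x) = L2_inner f g - L2_inner f h"
  using L2_integrable_cnj_mult[OF assms(1,2)] L2_integrable_cnj_mult[OF assms(1,3)]
  by (simp add: L2_inner_def right_diff_distrib)

lemma L2_norm_sq:
  assumes "f \<in> L2"
  shows "(L2_norm f)\<^sup>2 = qre (L2_inner f f)"
proof -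
  have "qre (L2_inner f f) = (LINT x|lebesgue. qre (quat_cnj (f x) * f x))"
    unfolding L2_inner_def
    by (rule integral_bounded_linear[symmetric, OF bounded_linear_qre L2_integrable_cnj_mult[OF assms assms]])
  also have "\<dots> = (LINT x|lebesgue. (norm (f x))\<^sup>2)"
    unfolding quat_cnj_mult_self by (simp add: of_real_def)
  also have "\<dots> = (L2_norm f)\<^sup>2"
    unfolding L2_norm_def by (simp add: integral_nonneg_AE)
  finally show ?thesis ..
qed

lemma L2_norm_nonneg [simp]: "0 \<le> L2_norm f"
  by (simp add: L2_norm_def integral_nonneg_AE)

lemma L2_norm_eq_0:
  assumes "f \<in> L2" "L2_norm f = 0"
  shows "AE x in lebesgue. f x = 0"
  using assms L2D[OF assms(1)] integral_nonneg_eq_0_iff_AE[of lebesgue "\<lambda>x. (norm (f x))\<^sup>2"]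
  by (simp add: L2_norm_def)

lemma L2_inner_cong_AE:
  assumes "f \<in> L2" "f' \<in> L2" "g \<in> L2" "g' \<in> L2"
    and "AE x in lebesgue. f x = f' x" "AE x in lebesgue. g x = g' x"
  shows "L2_inner f g = L2_inner f' g'"
proof -
  note [measurable] = assms(1-4)[THEN L2D(1)]
  have "AE x in lebesgue. quat_cnj (f x) * g x = quat_cnj (f' x) * g' x"
    using assms(5,6) by eventually_elim simp
  then show ?thesis unfolding L2_inner_def by (intro integral_cong_AE) measurable
qed

lemma L2_inner_affine:
  assumes "c \<noteq> 0" "f \<in> L2" "g \<in> L2"
  shows "L2_inner (\<lambda>x. f (t + c *\<^sub>R x)) (\<lambda>x. g (t + c *\<^sub>R x)) = (1 / c\<^sup>2) *\<^sub>R L2_inner f g"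
proof -
  note [measurable] = assms(2,3)[THEN L2D(1)]
  have "(\<lambda>x. quat_cnj (f x) * g x) \<in> borel_measurable lebesgue" by measurable
  from lebesgue_integral_affine[OF assms(1) this, of t] show ?thesis
    by (simp add: L2_inner_def)
qed

definition L2_orthonormal :: "('k \<Rightarrow> real^2 \<Rightarrow> quat) \<Rightarrow> bool" where
  "L2_orthonormal b \<longleftrightarrow> (\<forall>k. b k \<in> L2) \<and> (\<forall>k l. L2_inner (b k) (b l) = (if k = l then 1 else 0))"

lemma L2_orthonormal_inner_sum:
  assumes "L2_orthonormal b" "finite A"
  shows "L2_inner (b k) (\<lambda>x. \<Sum>l\<in>A. b l x * c l) = (if k \<in> A then c k else 0)"
proof -
  have b: "\<And>k. b k \<in> L2" "\<And>k l. L2_inner (b k) (b l) = (if k = l then 1 else 0)"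
    using assms by (auto simp: L2_orthonormal_def)
  have "L2_inner (b k) (\<lambda>x. \<Sum>l\<in>A. b l x * c l) = (\<Sum>l\<in>A. if k = l then c l else 0)"
    by (subst L2_inner_sum_right[OF b(1) b(1)], rule sum.cong) (auto simp: b(2))
  then show ?thesis using assms(2) by simp
qed

lemma L2_orthonormal_Parseval:
  assumes "L2_orthonormal b" "finite A" "finite B"
  shows "L2_inner (\<lambda>x. \<Sum>k\<in>A. b k x * c k) (\<lambda>x. \<Sum>k\<in>B. b k x * d k) = (\<Sum>k\<in>A\<inter>B. quat_cnj (c k) * d k)"
proof -
  let ?f = "\<lambda>x. \<Sum>k\<in>A. b k x * c k"
  have b: "\<And>k. b k \<in> L2" using assms by (auto simp: L2_orthonormal_def)
  have f: "?f \<in> L2" by (rule L2_sum[OF b])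
  have "L2_inner ?f (\<lambda>x. \<Sum>k\<in>B. b k x * d k) = (\<Sum>k\<in>B. L2_inner ?f (b k) * d k)"
    by (rule L2_inner_sum_right[OF f b])
  also have "\<dots> = (\<Sum>k\<in>B. if k \<in> A then quat_cnj (c k) * d k else 0)"
    by (intro sum.cong refl, subst L2_inner_cnj[OF b f])
       (simp add: L2_orthonormal_inner_sum[OF assms(1,2)])
  also have "\<dots> = (\<Sum>k\<in>A\<inter>B. quat_cnj (c k) * d k)"
    using assms(3) by (simp add: sum.inter_restrict[symmetric] Int_commute)
  finally show ?thesis .
qed

lemma L2_orthonormal_norm_sq_sum:
  assumes "L2_orthonormal b" "finite A"
  shows "(L2_norm (\<lambda>x. \<Sum>k\<in>A. b k x * c k))\<^sup>2 = (\<Sum>k\<in>A. (norm (c k))\<^sup>2)"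
proof -
  have b: "\<And>k. b k \<in> L2" using assms by (auto simp: L2_orthonormal_def)
  have "qre (\<Sum>k\<in>A. quat_cnj (c k) * c k) = (\<Sum>k\<in>A. (norm (c k))\<^sup>2)"
    unfolding quat_cnj_mult_self
    by (subst linear_sum[OF bounded_linear.linear[OF bounded_linear_qre]]) (simp add: of_real_def)
  then show ?thesis
    by (simp add: L2_norm_sq[OF L2_sum[OF b]] L2_orthonormal_Parseval[OF assms(1,2,2)])
qed

lemma L2_orthonormal_basis_imp_orthonormal:
  "V \<subseteq> L2 \<Longrightarrow> L2_orthonormal_basis b V \<Longrightarrow> L2_orthonormal b"
  by (auto simp: L2_orthonormal_def L2_orthonormal_basis_def)

text \<open>
  If \<open>s n\<close> lies in the span, then \<open>r\<close> is orthogonal to it, and Pythagoras gives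
  \<open>L2_norm r \<le> L2_norm (s n - r)\<close>, where the right-hand side can be made arbitrarily small.
\<close>

lemma L2_orthonormal_basis_complete:
  assumes V: "V \<subseteq> L2" and b: "L2_orthonormal_basis b V"
    and r: "r \<in> V" and 0: "\<And>k. L2_inner (b k) r = 0"
  shows "AE x in lebesgue. r x = 0"
proof (rule L2_norm_eq_0)
  show rL: "r \<in> L2" using V r by auto
  have bL: "\<And>k. b k \<in> L2"
    using L2_orthonormal_basis_imp_orthonormal[OF V b] by (simp add: L2_orthonormal_def)
  have "r \<in> L2_closure (right_span b)" using b r by (simp add: L2_orthonormal_basis_def)
  then obtain s where s: "\<And>n::nat. s n \<in> right_span b"
    and lim: "(\<lambda>n. L2_norm (\<lambda>x. s n x - r x)) \<longlonglongrightarrow> 0"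
    by (auto simp: L2_closure_def)
  have "L2_norm r \<le> L2_norm (\<lambda>x. s n x - r x)" for n
  proof -
    obtain F c where sn: "s n = (\<lambda>x. \<Sum>k\<in>F. b k x * c k)" "finite F"
      using s[of n] by (auto simp: right_span_def)
    have sL: "s n \<in> L2" unfolding sn by (rule L2_sum[OF bL])
    have d: "(\<lambda>x. s n x - r x) \<in> L2" by (rule L2_diff[OF sL rL])
    have rs: "L2_inner r (s n) = 0"
      unfolding sn by (subst L2_inner_sum_right[OF rL bL]) (simp add: L2_inner_cnj[OF bL rL] 0)
    then have sr: "L2_inner (s n) r = 0" by (subst L2_inner_cnj[OF rL sL]) simp
    have "(L2_norm (\<lambda>x. s n x - r x))\<^sup>2 = qre (L2_inner (\<lambda>x. s n x - r x) (s n) - L2_inner (\<lambda>x. s n x - r x) r)"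
      unfolding L2_norm_sq[OF d] by (subst L2_inner_diff_right[OF d sL rL]) simp
    also have "\<dots> = qre (quat_cnj (L2_inner (s n) (\<lambda>x. s n x - r x)) - quat_cnj (L2_inner r (\<lambda>x. s n x - r x)))"
      using L2_inner_cnj[OF sL d] L2_inner_cnj[OF rL d] by simp
    also have "\<dots> = (L2_norm (s n))\<^sup>2 + (L2_norm r)\<^sup>2"
      by (simp add: L2_inner_diff_right sL rL rs sr L2_norm_sq)
    finally have "(L2_norm r)\<^sup>2 \<le> (L2_norm (\<lambda>x. s n x - r x))\<^sup>2" by simp
    then show ?thesis by (rule power2_le_imp_le) simp
  qed
  then have "L2_norm r \<le> 0" using lim by (intro LIMSEQ_le_const) auto
  then show "L2_norm r = 0" by (simp add: order_antisym)
qed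

lemma closed_right_submodule_sum:
  assumes "closed_right_submodule V" "\<And>k. b k \<in> V"
  shows "(\<lambda>x. \<Sum>k\<in>A. b k x * c k) \<in> V"
proof (induction A rule: infinite_finite_induct)
  case (insert k A)
  then show ?case using assms by (simp add: closed_right_submodule_def)
qed (use assms(1) in \<open>simp_all add: closed_right_submodule_def\<close>)

text \<open>
  The remainder of the expansion lies in \<open>V\<close> and is orthogonal to the basis.
\<close>

lemma L2_orthonormal_basis_finite_expansion:
  assumes V: "closed_right_submodule V" and b: "L2_orthonormal_basis b V"
    and f: "f \<in> V" and A: "finite A" "\<And>k. k \<notin> A \<Longrightarrow> L2_inner (b k) f = 0"
  shows "AE x in lebesgue. f x = (\<Sum>k\<in>A. b k x * L2_inner (b k) f)"
proof -
  let ?g = "\<lambda>x. \<Sum>k\<in>A. b k x * L2_inner (b k) f"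
  have VL: "V \<subseteq> L2" using V by (simp add: closed_right_submodule_def)
  have on: "L2_orthonormal b" by (rule L2_orthonormal_basis_imp_orthonormal[OF VL b])
  have bV: "\<And>k. b k \<in> V" using b by (simp add: L2_orthonormal_basis_def)
  have bL: "\<And>k. b k \<in> L2" using bV VL by blast
  have g: "?g \<in> V" by (rule closed_right_submodule_sum[OF V bV])
  have "\<And>f g. f \<in> V \<Longrightarrow> g \<in> V \<Longrightarrow> (\<lambda>x. f x + g x) \<in> V"
    and "\<And>f c. f \<in> V \<Longrightarrow> (\<lambda>x. f x * c) \<in> V"
    using V by (simp_all add: closed_right_submodule_def)
  from this(1)[OF f this(2)[OF g, of "-1"]] have "(\<lambda>x. f x - ?g x) \<in> V" by simp
  moreover have "L2_inner (b k) (\<lambda>x. f x - ?g x) = 0" for k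
    using f g VL by (subst L2_inner_diff_right[OF bL])
      (auto simp: L2_orthonormal_inner_sum[OF on A(1)] A(2))
  ultimately have "AE x in lebesgue. f x - ?g x = 0"
    by (rule L2_orthonormal_basis_complete[OF VL b])
  then show ?thesis by simp
qed

text \<open>
  By Parseval, the squared distance of a partial sum from \<open>f\<close> is the sum of the squared
  coefficient errors: it vanishes as soon as the index set covers \<open>A\<close> and the coefficients agree,
  and it bounds each single error from above.
\<close>

lemma L2_has_sum_finite_expansion_unique:
  fixes b :: "'k \<Rightarrow> real^2 \<Rightarrow> quat"
  assumes on: "L2_orthonormal b" and A: "finite A" "\<And>k. k \<notin> A \<Longrightarrow> a k = 0"
    and f: "AE x in lebesgue. f x = (\<Sum>k\<in>A. b k x * a k)" "f \<in> L2"
  shows "L2_has_sum (\<lambda>k x. b k x * c k) f \<longleftrightarrow> c = a"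
proof -
  let ?h = "\<lambda>F x. (\<Sum>k\<in>F. b k x * c k) - f x"
  have bL: "\<And>k. b k \<in> L2" using on by (auto simp: L2_orthonormal_def)
  have norm: "(L2_norm (?h F))\<^sup>2 = (\<Sum>k\<in>F \<union> A. (norm ((if k \<in> F then c k else 0) - a k))\<^sup>2)" if "finite F" for F
  proof -
    let ?g = "\<lambda>x. \<Sum>k\<in>F \<union> A. b k x * ((if k \<in> F then c k else 0) - a k)"
    have e: "AE x in lebesgue. ?h F x = ?g x"
      using f(1)
    proof eventually_elim
      case (elim x)
      have "(\<Sum>k\<in>F. b k x * c k) = (\<Sum>k\<in>F \<union> A. b k x * (if k \<in> F then c k else 0))"
        using that A by (intro sum.mono_neutral_cong_left) auto
      moreover have "(\<Sum>k\<in>A. b k x * a k) = (\<Sum>k\<in>F \<union> A. b k x * a k)"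
        using that A by (intro sum.mono_neutral_left) auto
      ultimately show ?case by (simp add: elim right_diff_distrib sum_subtractf)
    qed
    have g: "?g \<in> L2" by (rule L2_sum[OF bL])
    have h: "?h F \<in> L2" by (intro L2_diff L2_sum bL f)
    have "(L2_norm (?h F))\<^sup>2 = (L2_norm ?g)\<^sup>2"
      unfolding L2_norm_sq[OF g] L2_norm_sq[OF h] L2_inner_cong_AE[OF h g h g e e] ..
    then show ?thesis using L2_orthonormal_norm_sq_sum[OF on, of "F \<union> A"] that A(1) by simp
  qed
  show ?thesis
  proof
    assume "c = a"
    have "L2_norm (?h F) = 0" if "finite F \<and> A \<subseteq> F" for F
    proof -
      have "(L2_norm (?h F))\<^sup>2 = 0"
        using that by (subst norm) (auto intro!: sum.neutral simp: \<open>c = a\<close>)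
      then show ?thesis by simp
    qed
    then have "\<forall>\<^sub>F F in finite_subsets_at_top UNIV. L2_norm (?h F) = 0"
      unfolding eventually_finite_subsets_at_top using A(1) by (intro exI[of _ A]) auto
    then show "L2_has_sum (\<lambda>k x. b k x * c k) f"
      unfolding L2_has_sum_def by (rule tendsto_eventually)
  next
    assume hs: "L2_has_sum (\<lambda>k x. b k x * c k) f"
    show "c = a"
    proof
      fix l :: 'k
      have "\<forall>\<^sub>F F in finite_subsets_at_top UNIV. finite F \<and> {l} \<subseteq> F"
        unfolding eventually_finite_subsets_at_top by (intro exI[of _ "{l}"]) auto
      then have "\<forall>\<^sub>F F in finite_subsets_at_top UNIV. norm (c l - a l) \<le> L2_norm (?h F)"
      proof eventually_elim
        case (elim F)
        have "(norm (c l - a l))\<^sup>2 = (\<Sum>k\<in>{l}. (norm ((if k \<in> F then c k else 0) - a k))\<^sup>2)"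
          using elim by simp
        also have "\<dots> \<le> (L2_norm (?h F))\<^sup>2"
          using elim A(1) unfolding norm[OF conjunct1[OF elim]] by (intro sum_mono2) auto
        finally show ?case by (rule power2_le_imp_le) simp
      qed
      with hs have "norm (c l - a l) \<le> 0"
        unfolding L2_has_sum_def by (rule tendsto_lowerbound) auto
      then show "c l = a l" by simp
    qed
  qed
qed

text \<open>
  On the support, \<open>norm (f x)\<close> is at most \<open>(norm (f x))\<^sup>2 + 1\<close>.
\<close>

lemma L2_integrable_compact_support:
  assumes f: "f \<in> L2" and S: "compact S" "AE x in lebesgue. x \<notin> S \<longrightarrow> f x = 0"
  shows "integrable lebesgue f"
proof (rule Bochner_Integration.integrable_bound)
  have "S \<in> lmeasurable" using S(1) by (rule lmeasurable_compact)
  then have "integrable lebesgue (indicator S :: _ \<Rightarrow> real)"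
    by (intro integrable_real_indicator) (auto simp: fmeasurable_def)
  then show "integrable lebesgue (\<lambda>x. (norm (f x))\<^sup>2 + indicator S x)"
    using L2D[OF f] by auto
  show "f \<in> borel_measurable lebesgue" using L2D[OF f] by simp
  have le: "norm q \<le> (norm q)\<^sup>2 + 1" for q :: quat
    using sum_squares_bound[of "norm q" 1] norm_ge_zero[of q] unfolding power_one mult_1_right by linarith
  show "AE x in lebesgue. norm (f x) \<le> norm ((norm (f x))\<^sup>2 + indicator S x)"
    using S(2)
  proof eventually_elim
    case (elim x)
    show ?case
    proof (cases "x \<in> S")
      case True
      then show ?thesis using le[of "f x"] by simp
    next
      case False
      then show ?thesis using elim by simp
    qed
  qed
qed

section \<open>The quaternionic Fourier transform of integrable functions\<close>

lemma measurable_wchar [measurable]: "wchar \<xi> \<in> borel_measurable lebesgue"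
proof (rule borel_measurable_lebesgue_continuous)
  show "continuous_on UNIV (wchar \<xi>)"
    unfolding wchar_cos_sin by (intro continuous_intros)
qed

lemma integrable_wchar_mult:
  assumes "integrable lebesgue f"
  shows "integrable lebesgue (\<lambda>x. wchar \<xi> x * f x)"
proof (rule Bochner_Integration.integrable_bound[OF assms])
  note [measurable] = borel_measurable_integrable[OF assms]
  show "(\<lambda>x. wchar \<xi> x * f x) \<in> borel_measurable lebesgue" by measurable
qed (simp add: norm_quat_mult)

lemma qft_eq: "qft f \<xi> = (LINT x|lebesgue. wchar \<xi> x * f x)"
  by (simp add: qft_def wchar_def)

lemma qft_cong_AE:
  assumes "f \<in> borel_measurable lebesgue" "g \<in> borel_measurable lebesgue" "AE x in lebesgue. f x = g x"
  shows "qft f \<xi> = qft g \<xi>"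
proof -
  note [measurable] = assms(1,2)
  show ?thesis unfolding qft_eq
    by (rule integral_cong_AE) (measurable, use assms(3) in eventually_elim, simp)
qed

text \<open>
  The kernel factors through the substitution because \<open>wchar \<xi> x\<close> is the product of the values of
  the character of frequency \<open>\<xi> / c\<close> at \<open>- t\<close> and at \<open>t + c *\<^sub>R x\<close>.
\<close>

lemma qft_affine:
  assumes "integrable lebesgue f" "c \<noteq> 0"
  shows "qft (\<lambda>x. f (t + c *\<^sub>R x)) \<xi> = (1 / c\<^sup>2) *\<^sub>R (wchar ((1/c) *\<^sub>R \<xi>) (- t) * qft f ((1/c) *\<^sub>R \<xi>))"
proof -
  note [measurable] = borel_measurable_integrable[OF assms(1)]
  let ?w = "wchar ((1/c) *\<^sub>R \<xi>)"
  have "wchar \<xi> x = ?w (- t) * ?w (t + c *\<^sub>R x)" for x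
    unfolding wchar_add[symmetric] by (simp add: wchar_scaleR assms(2))
  then have "qft (\<lambda>x. f (t + c *\<^sub>R x)) \<xi> =
      (LINT x|lebesgue. ?w (- t) * (?w (t + c *\<^sub>R x) * f (t + c *\<^sub>R x)))"
    by (simp add: qft_eq mult.assoc)
  also have "\<dots> = (1 / \<bar>c\<bar> ^ DIM(real^2)) *\<^sub>R (LINT x|lebesgue. ?w (- t) * (?w x * f x))"
    by (rule lebesgue_integral_affine[OF assms(2), of "\<lambda>x. ?w (- t) * (?w x * f x)"]) measurable
  also have "(LINT x|lebesgue. ?w (- t) * (?w x * f x)) = ?w (- t) * qft f ((1/c) *\<^sub>R \<xi>)"
    unfolding qft_eq by (rule Bochner_Integration.integral_mult_right) (rule integrable_wchar_mult[OF assms(1)])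
  finally show ?thesis by simp
qed

lemma norm_qft_le:
  assumes "integrable lebesgue f"
  shows "norm (qft f \<xi>) \<le> (LINT x|lebesgue. norm (f x))"
  using integral_norm_bound[of lebesgue "\<lambda>x. wchar \<xi> x * f x"] by (simp add: qft_eq norm_quat_mult)

lemma qft_lipschitz_at_0:
  assumes f: "integrable lebesgue f" and S: "bounded S" "AE x in lebesgue. x \<notin> S \<longrightarrow> f x = 0"
  obtains C where "\<And>\<xi>. norm (qft f \<xi> - qft f 0) \<le> C * norm \<xi>"
proof -
  obtain R where R: "\<And>x. x \<in> S \<Longrightarrow> norm x \<le> R" using S(1) by (auto simp: bounded_iff)
  have "norm (qft f \<xi> - qft f 0) \<le> (4 * pi * R * (LINT x|lebesgue. norm (f x))) * norm \<xi>" for \<xi>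
  proof -
    note i = integrable_wchar_mult[OF f, of \<xi>]
    have "norm (qft f \<xi> - qft f 0) = norm (LINT x|lebesgue. wchar \<xi> x * f x - f x)"
      using i f by (simp add: qft_eq)
    also have "\<dots> \<le> (LINT x|lebesgue. norm (wchar \<xi> x * f x - f x))"
      by (rule integral_norm_bound)
    also have "\<dots> \<le> (LINT x|lebesgue. 4 * pi * norm \<xi> * R * norm (f x))"
    proof (rule integral_mono_AE)
      show "AE x in lebesgue. norm (wchar \<xi> x * f x - f x) \<le> 4 * pi * norm \<xi> * R * norm (f x)"
        using S(2)
      proof eventually_elim
        case (elim x)
        have "norm (wchar \<xi> x * f x - f x) = norm (wchar \<xi> x - 1) * norm (f x)"
          by (simp add: left_diff_distrib flip: norm_quat_mult)
        also have "\<dots> \<le> 4 * pi * norm \<xi> * norm x * norm (f x)"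
          by (intro mult_right_mono norm_wchar_minus_1) auto
        also have "\<dots> \<le> 4 * pi * norm \<xi> * R * norm (f x)"
          using elim R[of x] by (cases "x \<in> S") (auto intro!: mult_right_mono mult_left_mono)
        finally show ?case .
      qed
    qed (use i f in auto)
    also have "\<dots> = 4 * pi * norm \<xi> * R * (LINT x|lebesgue. norm (f x))" by simp
    finally show ?thesis by (simp add: mult_ac)
  qed
  then show ?thesis by (rule that)
qed

text \<open>
  The wedge product is the inner product with a rotated frequency, so the characters are all the
  \<open>cos (t \<bullet> x) + sin (t \<bullet> x) e12\<close>. Averaging over \<open>\<xi>\<close> and \<open>- \<xi>\<close> separates cosine and sine.
\<close>

lemma qft_injective:
  assumes g: "integrable lebesgue g"
    and supp: "compact S" "AE x in lebesgue. x \<notin> S \<longrightarrow> g x = 0"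
    and 0: "\<And>\<xi>. qft g \<xi> = 0"
  shows "AE x in lebesgue. g x = 0"
proof (rule Fourier_injective[OF g supp])
  fix t :: "real^2"
  define \<xi> :: "real^2" where "\<xi> = vector [t$2 / (2 * pi), - t$1 / (2 * pi)]"
  have "2 * pi * (\<xi>$1 * x$2 - \<xi>$2 * x$1) = t \<bullet> x" for x
    by (simp add: \<xi>_def inner_vec_def sum_2 field_simps)
  then have p: "wchar \<xi> x = Quat (cos (t \<bullet> x)) 0 0 (sin (t \<bullet> x))" for x
    unfolding wchar_eq by simp
  have m: "wchar (- \<xi>) x = Quat (cos (t \<bullet> x)) 0 0 (- sin (t \<bullet> x))" for x
    unfolding wchar_minus p by (simp add: quat_eq_iff)
  note i = integrable_wchar_mult[OF g, of \<xi>] integrable_wchar_mult[OF g, of "- \<xi>"]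
  have z: "(LINT x|lebesgue. wchar \<xi> x * g x) = 0" "(LINT x|lebesgue. wchar (- \<xi>) x * g x) = 0"
    using 0 by (simp_all flip: qft_eq)
  have c: "cos (t \<bullet> x) *\<^sub>R g x = (1/2) *\<^sub>R (wchar \<xi> x * g x + wchar (- \<xi>) x * g x)" for x
    unfolding p m by (simp add: quat_eq_iff)
  have s: "sin (t \<bullet> x) *\<^sub>R g x = (- (1/2) *\<^sub>R e12) * (wchar \<xi> x * g x - wchar (- \<xi>) x * g x)" for x
    unfolding p m by (simp add: quat_eq_iff)
  show "(LINT x|lebesgue. cos (t \<bullet> x) *\<^sub>R g x) = 0"
    unfolding c using i z by simp
  show "(LINT x|lebesgue. sin (t \<bullet> x) *\<^sub>R g x) = 0"
    unfolding s by (subst Bochner_Integration.integral_mult_right) (use i z in auto)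
qed

section \<open>The filter at the origin\<close>

lemma lattice_vec_add: "lattice_vec (k + l) = lattice_vec k + lattice_vec l"
  and lattice_vec_diff: "lattice_vec (k - l) = lattice_vec k - lattice_vec l"
  by (simp_all add: lattice_vec_def vec_eq_iff)

text \<open>
  This is the classical identity that the squared moduli of the filter at the four half-lattice
  frequencies add up to one, in the form of a bound for its value at the origin. The coefficients are
  grouped by the parity class of their index. The squared moduli of the four class sums \<open>s \<rho>\<close> add
  up to the sum of all correlations at even shifts, which is \<open>1/4\<close>, and the total of four numbers
  with sum of squares \<open>1/4\<close> has modulus at most \<open>1\<close> by Cauchy-Schwarz.
\<close>

lemma norm_sum_le_1_if_even_correlations:
  fixes a :: "int^2 \<Rightarrow> quat"
  assumes A: "finite A"
    and corr: "\<And>l. (\<Sum>k\<in>{k\<in>A. k - (l + l) \<in> A}. quat_cnj (a k) * a (k - (l + l))) = (if l = 0 then of_real (1/4) else 0)"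
  shows "norm (\<Sum>k\<in>A. a k) \<le> 1"
proof -
  define par where "par k = (even (k $ 1), even (k $ 2))" for k :: "int^2"
  define s where "s \<rho> = (\<Sum>k\<in>{k\<in>A. par k = \<rho>}. a k)" for \<rho>
  define half :: "int^2 \<Rightarrow> int^2" where "half k = (\<chi> i. k $ i div 2)" for k
  \<comment> \<open>Pairs of indices of equal parity, to be sorted first by class and then by half their difference.\<close>
  define E where "E = {(k, k'). k \<in> A \<and> k' \<in> A \<and> par k = par k'}"
  \<comment> \<open>Zero is inserted so that the shift with nonzero correlation is present even if the coefficient set is empty.\<close>
  define L where "L = insert 0 ((\<lambda>(k, k'). half (k - k')) ` E)"
  have finE: "finite E"
    by (rule finite_subset[of _ "A \<times> A"]) (auto simp: E_def A)
  have finL: "finite L" using finE by (simp add: L_def)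
  have half: "k' = k - (half (k - k') + half (k - k'))" if "par k = par k'" for k k'
  proof -
    have "even ((k - k') $ i)" for i
      using that exhaust_2[of i] by (auto simp: par_def)
    then have "(k - k') $ i = half (k - k') $ i + half (k - k') $ i" for i
      by (simp add: half_def del: vector_minus_component)
    then show ?thesis by (simp add: vec_eq_iff algebra_simps)
  qed
  have par: "par (k - (l + l)) = par k" for k l by (simp add: par_def)
  have half': "half (k - (k - (l + l))) = l" for k l by (simp add: half_def vec_eq_iff)
  have "(\<Sum>\<rho>\<in>UNIV. quat_cnj (s \<rho>) * s \<rho>)
      = (\<Sum>\<rho>\<in>UNIV. \<Sum>k\<in>{k\<in>A. par k = \<rho>}. \<Sum>k'\<in>{k'\<in>A. par k' = par k}. quat_cnj (a k) * a k')"
    unfolding s_def quat_cnj_sum sum_product by (intro sum.cong refl) auto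
  also have "\<dots> = (\<Sum>k\<in>A. \<Sum>k'\<in>{k'\<in>A. par k' = par k}. quat_cnj (a k) * a k')"
    by (rule sum.group) (auto simp: A)
  also have "\<dots> = (\<Sum>p\<in>E. quat_cnj (a (fst p)) * a (snd p))"
    by (subst sum.Sigma) (auto simp: A E_def intro!: sum.cong)
  also have "\<dots> = (\<Sum>l\<in>L. \<Sum>p\<in>{p\<in>E. half (fst p - snd p) = l}. quat_cnj (a (fst p)) * a (snd p))"
    by (rule sum.group[symmetric, OF finE finL]) (force simp: L_def)
  also have "\<dots> = (\<Sum>l\<in>L. \<Sum>k\<in>{k\<in>A. k - (l + l) \<in> A}. quat_cnj (a k) * a (k - (l + l)))"
  proof (rule sum.cong[OF refl])
    fix l
    show "(\<Sum>p\<in>{p\<in>E. half (fst p - snd p) = l}. quat_cnj (a (fst p)) * a (snd p))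
        = (\<Sum>k\<in>{k\<in>A. k - (l + l) \<in> A}. quat_cnj (a k) * a (k - (l + l)))"
    proof (rule sum.reindex_bij_witness[where i = "\<lambda>k. (k, k - (l + l))" and j = fst])
      fix p assume p: "p \<in> {p\<in>E. half (fst p - snd p) = l}"
      then have "snd p = fst p - (l + l)" using half[of "fst p" "snd p"] by (auto simp: E_def)
      with p show "(fst p, fst p - (l + l)) = p" "fst p \<in> {k\<in>A. k - (l + l) \<in> A}"
        "quat_cnj (a (fst p)) * a (fst p - (l + l)) = quat_cnj (a (fst p)) * a (snd p)"
        by (auto simp: E_def prod_eq_iff)
    next
      fix k assume "k \<in> {k\<in>A. k - (l + l) \<in> A}"
      then show "(k, k - (l + l)) \<in> {p\<in>E. half (fst p - snd p) = l}"
        unfolding E_def by (simp only: mem_Collect_eq prod.case fst_conv snd_conv par half' simp_thms)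
    qed auto
  qed
  also have "\<dots> = of_real (1/4)"
    unfolding corr using finL by (simp add: L_def)
  finally have "(\<Sum>\<rho>\<in>UNIV. of_real ((norm (s \<rho>))\<^sup>2) :: quat) = of_real (1/4)"
    unfolding quat_cnj_mult_self .
  then have Q: "(\<Sum>\<rho>\<in>UNIV. (norm (s \<rho>))\<^sup>2) = 1/4"
    unfolding of_real_sum[symmetric] of_real_eq_iff .
  have "(\<Sum>k\<in>A. a k) = (\<Sum>\<rho>\<in>UNIV. s \<rho>)"
    unfolding s_def by (rule sum.group[symmetric]) (auto simp: A)
  then have "norm (\<Sum>k\<in>A. a k) \<le> (\<Sum>\<rho>\<in>UNIV. norm (s \<rho>))" by (simp add: norm_sum)
  then have "(norm (\<Sum>k\<in>A. a k))\<^sup>2 \<le> (\<Sum>\<rho>\<in>UNIV. norm (s \<rho>))\<^sup>2" by (intro power_mono) auto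
  also have "\<dots> \<le> 4 * (\<Sum>\<rho>\<in>UNIV. (norm (s \<rho>))\<^sup>2)"
    using sum_squared_le_sum_of_squares[of "\<lambda>\<rho>. norm (s \<rho>)" UNIV]
    by simp
  also have "\<dots> = 1" by (simp add: Q)
  finally show ?thesis by (simp add: power_le_one_iff abs_square_le_1)
qed

section \<open>The refinement equation of a scaling function\<close>

abbreviation translate :: "(real^2 \<Rightarrow> quat) \<Rightarrow> int^2 \<Rightarrow> real^2 \<Rightarrow> quat" where
  "translate \<phi> k \<equiv> (\<lambda>x. \<phi> (x - lattice_vec k))"

abbreviation half_dilate :: "(real^2 \<Rightarrow> quat) \<Rightarrow> real^2 \<Rightarrow> quat" where
  "half_dilate \<phi> \<equiv> (\<lambda>x. (1/4) *\<^sub>R \<phi> ((1/2) *\<^sub>R x))"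

text \<open>
  The Fourier coefficients of the dilated scaling function; they turn out to be the scaling
  coefficients.
\<close>

definition refinement_coeff :: "(real^2 \<Rightarrow> quat) \<Rightarrow> int^2 \<Rightarrow> quat" where
  "refinement_coeff \<phi> k = L2_inner (translate \<phi> k) (half_dilate \<phi>)"

definition refinement_support :: "(real^2 \<Rightarrow> quat) \<Rightarrow> (int^2) set" where
  "refinement_support \<phi> = {k. refinement_coeff \<phi> k \<noteq> 0}"

text \<open>
  If \<open>x - k\<close> and \<open>x / 2\<close> both lie in the square, each coordinate of \<open>k\<close> lies between \<open>- N\<close>
  and \<open>2 * N\<close>.
\<close>

lemma finite_refinement_support:
  assumes "AE x in lebesgue. x \<notin> cbox 0 (vector [N, N]) \<longrightarrow> \<phi> x = 0"
  shows "finite (refinement_support \<phi>)"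
proof -
  define S where "S = {- \<lceil>N\<rceil>..2 * \<lceil>N\<rceil>}"
  have "refinement_support \<phi> \<subseteq> (\<lambda>(x, y). vector [x, y]) ` (S \<times> S)"
  proof
    fix k assume k: "k \<in> refinement_support \<phi>"
    have "k $ i \<in> S" for i
    proof (rule ccontr)
      assume i: "k $ i \<notin> S"
      have "AE x in lebesgue. - lattice_vec k + 1 *\<^sub>R x \<notin> cbox 0 (vector [N, N]) \<longrightarrow> \<phi> (- lattice_vec k + 1 *\<^sub>R x) = 0"
        by (rule AE_lebesgue_affine[OF _ assms]) simp
      moreover have "AE x in lebesgue. 0 + (1/2) *\<^sub>R x \<notin> cbox 0 (vector [N, N]) \<longrightarrow> \<phi> (0 + (1/2) *\<^sub>R x) = 0"
        by (rule AE_lebesgue_affine[OF _ assms]) simp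
      ultimately have "AE x in lebesgue. quat_cnj (translate \<phi> k x) * half_dilate \<phi> x = 0"
      proof eventually_elim
        case (elim x)
        have v: "vector [N, N] $ i = N" using exhaust_2[of i] by auto
        have "\<not> (x - lattice_vec k \<in> cbox 0 (vector [N, N]) \<and> (1/2) *\<^sub>R x \<in> cbox 0 (vector [N, N]))"
        proof
          assume "x - lattice_vec k \<in> cbox 0 (vector [N, N]) \<and> (1/2) *\<^sub>R x \<in> cbox 0 (vector [N, N])"
          then have "0 \<le> x $ i - of_int (k $ i)" "x $ i - of_int (k $ i) \<le> N"
            "0 \<le> x $ i / 2" "x $ i / 2 \<le> N"
            by (auto simp: mem_box_cart lattice_vec_def v dest!: spec[of _ i])
          then have "- N \<le> of_int (k $ i)" "of_int (k $ i) \<le> 2 * N" by linarith+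
          then have "k $ i \<in> S" unfolding S_def by (auto; linarith)
          with i show False ..
        qed
        then show ?case using elim by (auto simp: algebra_simps)
      qed
      then have "refinement_coeff \<phi> k = 0"
        unfolding refinement_coeff_def L2_inner_def by (rule integral_eq_zero_AE)
      then show False using k by (simp add: refinement_support_def)
    qed
    moreover have "k = vector [k $ 1, k $ 2]"
      by (simp add: vec_eq_iff forall_2)
    ultimately show "k \<in> (\<lambda>(x, y). vector [x, y]) ` (S \<times> S)" by force
  qed
  then show ?thesis by (rule finite_subset) (simp add: S_def)
qed

text \<open>
  The dilated scaling function is in the space of index \<open>-1\<close>, hence in that of index \<open>0\<close>.
\<close>

lemma MRA_orthonormal:
  assumes "MRA V \<phi>"
  shows "L2_orthonormal (translate \<phi>)" "\<phi> \<in> L2" "\<And>k. translate \<phi> k \<in> L2" "half_dilate \<phi> \<in> L2"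
    "half_dilate \<phi> \<in> V 0"
proof -
  have V: "closed_right_submodule (V 0)" and b: "L2_orthonormal_basis (translate \<phi>) (V 0)"
    and V1: "V (-1) \<subseteq> V (-1 + 1)" and p: "\<phi> \<in> V 0"
    and d: "\<And>f j. f \<in> V 0 \<longleftrightarrow> (\<lambda>x. f ((2 powi j) *\<^sub>R x)) \<in> V j"
    using assms unfolding MRA_def by blast+
  have VL: "V 0 \<subseteq> L2" using V by (simp add: closed_right_submodule_def)
  show "L2_orthonormal (translate \<phi>)" by (rule L2_orthonormal_basis_imp_orthonormal[OF VL b])
  then show "\<And>k. translate \<phi> k \<in> L2" by (simp add: L2_orthonormal_def)
  show "\<phi> \<in> L2" using p VL by blast
  have "(\<lambda>x. \<phi> ((2 powi (-1)) *\<^sub>R x)) \<in> V (-1)" using d[of \<phi> "-1"] p by blast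
  then have "(\<lambda>x. \<phi> ((1/2) *\<^sub>R x)) \<in> V 0" using V1 by (auto simp: power_int_minus)
  moreover have "\<And>f c. f \<in> V 0 \<Longrightarrow> (\<lambda>x. f x * c) \<in> V 0"
    using V by (simp add: closed_right_submodule_def)
  ultimately have "(\<lambda>x. \<phi> ((1/2) *\<^sub>R x) * of_real (1/4)) \<in> V 0" by blast
  then show "half_dilate \<phi> \<in> V 0" by (simp add: of_real_def)
  then show "half_dilate \<phi> \<in> L2" using VL by blast
qed

lemma refinement_equation:
  assumes "MRA V \<phi>" and fin: "finite (refinement_support \<phi>)"
  shows "AE x in lebesgue. half_dilate \<phi> x =
    (\<Sum>k\<in>refinement_support \<phi>. translate \<phi> k x * refinement_coeff \<phi> k)"
proof -
  have V: "closed_right_submodule (V 0)" and b: "L2_orthonormal_basis (translate \<phi>) (V 0)"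
    using assms unfolding MRA_def by blast+
  show ?thesis
    unfolding refinement_coeff_def
    by (rule L2_orthonormal_basis_finite_expansion[OF V b MRA_orthonormal(5)[OF assms(1)] fin])
       (simp add: refinement_support_def refinement_coeff_def)
qed

lemma scaling_coeffs_eq:
  assumes "MRA V \<phi>" and fin: "finite (refinement_support \<phi>)"
  shows "scaling_coeffs \<phi> = refinement_coeff \<phi>"
proof -
  have iff: "L2_has_sum (\<lambda>k x. \<phi> (x - lattice_vec k) * c k) (half_dilate \<phi>) \<longleftrightarrow> c = refinement_coeff \<phi>" for c
    by (rule L2_has_sum_finite_expansion_unique[OF MRA_orthonormal(1)[OF assms(1)] fin _
          refinement_equation[OF assms] MRA_orthonormal(4)[OF assms(1)]])
       (simp add: refinement_support_def)
  have "(\<lambda>k. (norm (refinement_coeff \<phi> k))\<^sup>2) summable_on UNIV"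
    by (rule finite_nonzero_values_imp_summable_on)
       (use fin in \<open>simp add: refinement_support_def\<close>)
  then show ?thesis
    unfolding scaling_coeffs_def iff by (intro the_equality) auto
qed

lemma scaling_filter_eq:
  assumes "MRA V \<phi>" and fin: "finite (refinement_support \<phi>)"
  shows "scaling_filter \<phi> \<xi> = (\<Sum>k\<in>refinement_support \<phi>. wchar \<xi> (lattice_vec k) * refinement_coeff \<phi> k)"
proof -
  have "scaling_filter \<phi> \<xi> = (\<Sum>\<^sub>\<infinity>k\<in>refinement_support \<phi>. wchar \<xi> (lattice_vec k) * refinement_coeff \<phi> k)"
    unfolding scaling_filter_def scaling_coeffs_eq[OF assms] wchar_def
    by (rule infsum_cong_neutral) (auto simp: refinement_support_def)
  then show ?thesis using fin by simp
qed

text \<open>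
  The translates by even vectors of the dilated scaling function are dilates of the orthonormal
  translates of \<open>\<phi>\<close>, hence orthogonal with squared norm \<open>4 / 16\<close>. Expanded by the refinement
  equation, this is the correlation condition on the coefficients.
\<close>

lemma norm_scaling_filter_0:
  assumes mra: "MRA V \<phi>" and fin: "finite (refinement_support \<phi>)"
  shows "norm (scaling_filter \<phi> 0) \<le> 1"
proof -
  let ?A = "refinement_support \<phi>" and ?a = "refinement_coeff \<phi>"
  note on = MRA_orthonormal[OF mra]
  have "norm (\<Sum>k\<in>?A. ?a k) \<le> 1"
  proof (rule norm_sum_le_1_if_even_correlations[OF fin])
    fix l :: "int^2"
    define f' where "f' x = half_dilate \<phi> (- lattice_vec (l + l) + 1 *\<^sub>R x)" for x
    have f'L: "f' \<in> L2" unfolding f'_def by (rule L2_affine[OF on(4)]) simp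
    have inj: "inj_on (\<lambda>k. k + (l + l)) ?A" by (simp add: inj_on_def)
    have "AE x in lebesgue. f' x = (\<Sum>k\<in>?A. translate \<phi> k (- lattice_vec (l + l) + 1 *\<^sub>R x) * ?a k)"
      unfolding f'_def by (rule AE_lebesgue_affine[OF _ refinement_equation[OF mra fin]]) simp
    then have f'_eq: "AE x in lebesgue. f' x = (\<Sum>k\<in>(\<lambda>k. k + (l + l)) ` ?A. translate \<phi> k x * ?a (k - (l + l)))"
      by (subst sum.reindex[OF inj]) (simp add: lattice_vec_add algebra_simps)
    have "L2_inner (half_dilate \<phi>) f' =
      L2_inner (\<lambda>x. \<Sum>k\<in>?A. translate \<phi> k x * ?a k)
        (\<lambda>x. \<Sum>k\<in>(\<lambda>k. k + (l + l)) ` ?A. translate \<phi> k x * ?a (k - (l + l)))"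
      by (rule L2_inner_cong_AE[OF on(4) _ f'L _ refinement_equation[OF mra fin] f'_eq])
         (rule L2_sum[OF on(3)])+
    also have "\<dots> = (\<Sum>k\<in>?A \<inter> (\<lambda>k. k + (l + l)) ` ?A. quat_cnj (?a k) * ?a (k - (l + l)))"
      using fin by (intro L2_orthonormal_Parseval[OF on(1)]) auto
    also have "?A \<inter> (\<lambda>k. k + (l + l)) ` ?A = {k\<in>?A. k - (l + l) \<in> ?A}"
      by (auto simp: image_iff) (metis diff_add_cancel)
    finally have 1: "L2_inner (half_dilate \<phi>) f' = (\<Sum>k\<in>{k\<in>?A. k - (l + l) \<in> ?A}. quat_cnj (?a k) * ?a (k - (l + l)))" .
    have *: "(1/2) *\<^sub>R (- lattice_vec (l + l) + 1 *\<^sub>R x) = (0 + (1/2) *\<^sub>R x) - lattice_vec l" for x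
      by (simp add: lattice_vec_def vec_eq_iff)
    have "L2_inner (half_dilate \<phi>) f' =
        (1/16) *\<^sub>R L2_inner (\<lambda>x. translate \<phi> 0 (0 + (1/2) *\<^sub>R x)) (\<lambda>x. translate \<phi> l (0 + (1/2) *\<^sub>R x))"
      unfolding f'_def * L2_inner_def
      by (simp add: lattice_vec_def linear_scale[OF bounded_linear.linear[OF bounded_linear_quat_cnj]]
          flip: zero_vec_def)
    also have "\<dots> = (1/4) *\<^sub>R L2_inner (translate \<phi> 0) (translate \<phi> l)"
      by (subst L2_inner_affine[OF _ on(3) on(3)]) (auto simp: power2_eq_square)
    also have "\<dots> = (if l = 0 then of_real (1/4) else 0)"
      using on(1) by (auto simp: L2_orthonormal_def of_real_def)
    finally show "(\<Sum>k\<in>{k\<in>?A. k - (l + l) \<in> ?A}. quat_cnj (?a k) * ?a (k - (l + l))) = (if l = 0 then of_real (1/4) else 0)"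
      unfolding 1 .
  qed
  then show ?thesis by (simp add: scaling_filter_eq[OF assms])
qed

lemma qft_refinement_equation:
  assumes mra: "MRA V \<phi>" and fin: "finite (refinement_support \<phi>)" and int: "integrable lebesgue \<phi>"
  shows "qft \<phi> (2 *\<^sub>R \<xi>) = twisted_mult (scaling_filter \<phi>) \<xi> (qft \<phi> \<xi>)"
proof -
  let ?A = "refinement_support \<phi>" and ?a = "refinement_coeff \<phi>"
  note on = MRA_orthonormal[OF mra]
  have tr: "qft (translate \<phi> k) \<xi> = wchar \<xi> (lattice_vec k) * qft \<phi> \<xi>" for k
    using qft_affine[OF int, of 1 "- lattice_vec k" \<xi>] by simp
  have tr_int: "integrable lebesgue (translate \<phi> k)" for k
    using lebesgue_integrable_affine[of 1 \<phi> "- lattice_vec k"] int by auto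
  have "qft (half_dilate \<phi>) \<xi> = (LINT x|lebesgue. (1/4) *\<^sub>R (wchar \<xi> x * \<phi> (0 + (1/2) *\<^sub>R x)))"
    by (simp add: qft_eq)
  also have "\<dots> = (1/4) *\<^sub>R qft (\<lambda>x. \<phi> (0 + (1/2) *\<^sub>R x)) \<xi>"
    unfolding qft_eq by (rule integral_scaleR_right)
  also have "\<dots> = qft \<phi> (2 *\<^sub>R \<xi>)"
    by (subst qft_affine[OF int]) (auto simp: power2_eq_square)
  finally have "qft \<phi> (2 *\<^sub>R \<xi>) = qft (half_dilate \<phi>) \<xi>" ..
  also have "\<dots> = qft (\<lambda>x. \<Sum>k\<in>?A. translate \<phi> k x * ?a k) \<xi>"
    by (rule qft_cong_AE[OF L2D(1)[OF on(4)] L2D(1)[OF L2_sum[OF on(3)]] refinement_equation[OF mra fin]])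
  also have "\<dots> = (\<Sum>k\<in>?A. qft (translate \<phi> k) \<xi> * ?a k)"
    using integrable_wchar_mult[OF tr_int] by (simp add: qft_eq sum_distrib_left flip: mult.assoc)
  also have "\<dots> = twisted_mult (scaling_filter \<phi>) \<xi> (qft \<phi> \<xi>)"
    by (subst twisted_mult_eq_sum[OF scaling_filter_eq[OF mra fin]]) (simp add: tr)
  finally show ?thesis .
qed

section \<open>Symmetry of the scaling function, of its transform and of its filter\<close>

text \<open>
  The transforms of \<open>\<phi>\<close> and of its reflection solve the same dilation equation, as the filter
  is symmetric, and agree at the origin. Their difference \<open>d\<close> is therefore a solution that is
  bounded by a multiple of the norm, and only the zero solution is.
\<close>

lemma qft_symmetric_if_filter_symmetric:
  assumes mra: "MRA V \<phi>" and fin: "finite (refinement_support \<phi>)"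
    and int: "integrable lebesgue \<phi>" and S: "bounded S" "AE x in lebesgue. x \<notin> S \<longrightarrow> \<phi> x = 0"
    and sym: "\<And>\<xi>. scaling_filter \<phi> \<xi> = wchar \<xi> c * scaling_filter \<phi> (- \<xi>)"
  shows "qft \<phi> \<xi> = wchar \<xi> c * qft \<phi> (- \<xi>)"
proof -
  let ?m = "scaling_filter \<phi>"
  define d where "d \<xi> = qft \<phi> \<xi> - wchar \<xi> c * qft \<phi> (- \<xi>)" for \<xi>
  have eq: "d (2 *\<^sub>R \<xi>) = twisted_mult ?m \<xi> (d \<xi>)" for \<xi>
  proof -
    have "qft \<phi> (2 *\<^sub>R (- \<xi>)) = twisted_mult ?m (- \<xi>) (qft \<phi> (- \<xi>))"
      by (rule qft_refinement_equation[OF mra fin int])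
    then show ?thesis
      by (simp add: d_def twisted_mult_diff twisted_mult_wchar[OF sym]
          qft_refinement_equation[OF mra fin int])
  qed
  obtain C where C: "\<And>\<xi>. norm (qft \<phi> \<xi> - qft \<phi> 0) \<le> C * norm \<xi>"
    by (rule qft_lipschitz_at_0[OF int S]) blast
  define I where "I = (LINT x|lebesgue. norm (\<phi> x))"
  have lip: "norm (d \<xi>) \<le> (C + C + 4 * pi * norm c * I) * norm \<xi>" for \<xi>
  proof -
    have "d \<xi> = (qft \<phi> \<xi> - qft \<phi> 0) - (qft \<phi> (- \<xi>) - qft \<phi> 0) - (wchar \<xi> c - 1) * qft \<phi> (- \<xi>)"
      by (simp add: d_def algebra_simps)
    also have "norm \<dots> \<le> C * norm \<xi> + C * norm (- \<xi>) + (4 * pi * norm \<xi> * norm c) * I"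
    proof (rule order_trans[OF norm_triangle_ineq4 add_mono[OF order_trans[OF norm_triangle_ineq4 add_mono[OF C C]]]])
      show "norm ((wchar \<xi> c - 1) * qft \<phi> (- \<xi>)) \<le> 4 * pi * norm \<xi> * norm c * I"
        unfolding norm_quat_mult I_def
        by (intro mult_mono norm_wchar_minus_1 norm_qft_le int) auto
    qed
    finally show ?thesis by (simp add: algebra_simps)
  qed
  have "continuous (at 0) (\<lambda>\<xi>. \<Sum>k\<in>refinement_support \<phi>. wchar \<xi> (lattice_vec k) * refinement_coeff \<phi> k)"
    unfolding wchar_cos_sin by (intro continuous_intros)
  then have "continuous (at 0) ?m"
    by (simp add: scaling_filter_eq[OF mra fin, abs_def])
  then have "d \<xi> = 0"
    by (rule dilation_equation_zero[OF eq lip _ norm_scaling_filter_0[OF mra fin]])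
  then show ?thesis by (simp add: d_def)
qed

lemma qft_reflect:
  assumes "integrable lebesgue \<phi>"
  shows "qft (\<lambda>x. \<phi> (c - x)) \<xi> = wchar \<xi> c * qft \<phi> (- \<xi>)"
  using qft_affine[OF assms, of "-1" c \<xi>] by (simp add: wchar_uminus)

text \<open>
  The hypothesis says that \<open>\<phi>\<close> and its reflection have the same transform.
\<close>

lemma symmetric_if_qft_symmetric:
  assumes int: "integrable lebesgue \<phi>" and S: "compact S" "AE x in lebesgue. x \<notin> S \<longrightarrow> \<phi> x = 0"
    and sym: "\<And>\<xi>. qft \<phi> \<xi> = wchar \<xi> c * qft \<phi> (- \<xi>)"
  shows "AE x in lebesgue. \<phi> x = \<phi> (c - x)"
proof -
  let ?\<psi> = "\<lambda>x. \<phi> (c - x)"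
  have int': "integrable lebesgue ?\<psi>"
    using lebesgue_integrable_affine[of "-1" \<phi> c] int by auto
  have "AE x in lebesgue. c + (-1) *\<^sub>R x \<notin> S \<longrightarrow> \<phi> (c + (-1) *\<^sub>R x) = 0"
    by (rule AE_lebesgue_affine[OF _ S(2)]) simp
  then have S': "AE x in lebesgue. x \<notin> S \<union> (\<lambda>x. c - x) ` S \<longrightarrow> \<phi> x - ?\<psi> x = 0"
    using S(2)
  proof eventually_elim
    case (elim x)
    then show ?case using image_eqI[of x "\<lambda>x. c - x" "c - x" S] by auto
  qed
  have "AE x in lebesgue. \<phi> x - ?\<psi> x = 0"
  proof (rule qft_injective[OF _ _ S'])
    show "compact (S \<union> (\<lambda>x. c - x) ` S)"
      by (intro compact_Un compact_continuous_image S continuous_intros)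
    show "qft (\<lambda>x. \<phi> x - ?\<psi> x) \<xi> = 0" for \<xi>
    proof -
      have "qft (\<lambda>x. \<phi> x - ?\<psi> x) \<xi> = qft \<phi> \<xi> - qft ?\<psi> \<xi>"
        using integrable_wchar_mult[OF int] integrable_wchar_mult[OF int']
        by (simp add: qft_eq right_diff_distrib)
      then show ?thesis using sym[of \<xi>] by (simp add: qft_reflect[OF int])
    qed
  qed (use int int' in auto)
  then show ?thesis by simp
qed

text \<open>
  If \<open>\<phi>\<close> is symmetric about half of the lattice vector of \<open>\<kappa>\<close>, its dilate is symmetric about
  that vector itself. Reflecting the integral that defines a coefficient about this vector exchanges
  the indices \<open>k\<close> and \<open>\<kappa> - k\<close>.
\<close>

lemma filter_symmetric_if_symmetric:
  assumes mra: "MRA V \<phi>" and fin: "finite (refinement_support \<phi>)"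
    and sym: "AE x in lebesgue. \<phi> x = \<phi> (lattice_vec \<kappa> - x)"
  shows "scaling_filter \<phi> \<xi> = wchar \<xi> (lattice_vec \<kappa>) * scaling_filter \<phi> (- \<xi>)"
proof -
  let ?A = "refinement_support \<phi>" and ?a = "refinement_coeff \<phi>"
  let ?c = "lattice_vec \<kappa>"
  note on = MRA_orthonormal[OF mra]
  have a_sym: "?a (\<kappa> - k) = ?a k" for k
  proof -
    let ?F = "translate \<phi> (\<kappa> - k)" and ?G = "half_dilate \<phi>"
    let ?r = "\<lambda>x. 2 *\<^sub>R ?c + (-1) *\<^sub>R x"
    have "?a (\<kappa> - k) = L2_inner (\<lambda>x. ?F (?r x)) (\<lambda>x. ?G (?r x))"
      unfolding refinement_coeff_def by (subst L2_inner_affine[OF _ on(3) on(4)]) auto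
    also have "\<dots> = ?a k"
      unfolding refinement_coeff_def
    proof (rule L2_inner_cong_AE)
      show "(\<lambda>x. ?F (?r x)) \<in> L2" by (rule L2_affine[OF on(3)]) simp
      show "(\<lambda>x. ?G (?r x)) \<in> L2" by (rule L2_affine[OF on(4)]) simp
      have "AE x in lebesgue. \<phi> (- lattice_vec k + 1 *\<^sub>R x) = \<phi> (?c - (- lattice_vec k + 1 *\<^sub>R x))"
        by (rule AE_lebesgue_affine[OF _ sym]) simp
      then show "AE x in lebesgue. ?F (?r x) = translate \<phi> k x"
        by eventually_elim (simp add: lattice_vec_diff scaleR_2 algebra_simps)
      have "AE x in lebesgue. \<phi> (0 + (1/2) *\<^sub>R x) = \<phi> (?c - (0 + (1/2) *\<^sub>R x))"
        by (rule AE_lebesgue_affine[OF _ sym]) simp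
      then show "AE x in lebesgue. ?G (?r x) = half_dilate \<phi> x"
        by eventually_elim (simp add: scaleR_right_diff_distrib)
    qed (rule on)+
    finally show ?thesis .
  qed
  have "scaling_filter \<phi> \<xi> = (\<Sum>k\<in>?A. wchar \<xi> (lattice_vec (\<kappa> - k)) * ?a (\<kappa> - k))"
    unfolding scaling_filter_eq[OF mra fin]
    by (rule sum.reindex_bij_witness[where i = "\<lambda>k. \<kappa> - k" and j = "\<lambda>k. \<kappa> - k"])
       (auto simp: refinement_support_def a_sym)
  also have "\<dots> = (\<Sum>k\<in>?A. wchar \<xi> ?c * (wchar (- \<xi>) (lattice_vec k) * ?a k))"
  proof (rule sum.cong[OF refl])
    fix k
    have "lattice_vec (\<kappa> - k) = ?c + (- lattice_vec k)" by (simp add: lattice_vec_diff)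
    then show "wchar \<xi> (lattice_vec (\<kappa> - k)) * ?a (\<kappa> - k) = wchar \<xi> ?c * (wchar (- \<xi>) (lattice_vec k) * ?a k)"
      by (simp only: wchar_add wchar_uminus a_sym mult.assoc)
  qed
  finally show ?thesis
    by (simp add: scaling_filter_eq[OF mra fin] sum_distrib_left)
qed

theorem theorem3p13:
  fixes \<eta> :: nat and P :: "real^2"
    and V :: "int \<Rightarrow> (real^2 \<Rightarrow> quat) set" and \<phi> m0 :: "real^2 \<Rightarrow> quat"
  assumes "even \<eta>" and "\<eta> \<ge> 4"
    and "P = vector [(real \<eta> - 1) / 2, (real \<eta> - 1) / 2]"
    and "MRA V \<phi>"
    and "AE x in lebesgue. x \<notin> cbox 0 (vector [real \<eta> - 1, real \<eta> - 1]) \<longrightarrow> \<phi> x = 0"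
    and "m0 = scaling_filter \<phi>"
  shows "((AE x in lebesgue. \<phi> x = \<phi> (2 *\<^sub>R P - x)) \<longleftrightarrow>
          (\<forall>\<xi>. qft \<phi> \<xi> = exp ((4 * pi) *\<^sub>R (\<xi> \<^bold>\<and> P)) * qft \<phi> (- \<xi>))) \<and>
         ((\<forall>\<xi>. qft \<phi> \<xi> = exp ((4 * pi) *\<^sub>R (\<xi> \<^bold>\<and> P)) * qft \<phi> (- \<xi>)) \<longleftrightarrow>
          (\<forall>\<xi>. m0 \<xi> = exp ((4 * pi) *\<^sub>R (\<xi> \<^bold>\<and> P)) * m0 (- \<xi>)))"
proof -
  define \<kappa> :: "int^2" where "\<kappa> = vector [int \<eta> - 1, int \<eta> - 1]"
  have \<kappa>: "2 *\<^sub>R P = lattice_vec \<kappa>"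
    by (simp add: assms(3) \<kappa>_def lattice_vec_def vec_eq_iff forall_2)
  have w: "exp ((4 * pi) *\<^sub>R (\<xi> \<^bold>\<and> P)) = wchar \<xi> (2 *\<^sub>R P)" for \<xi>
    by (simp add: wchar_def wedge_def algebra_simps)
  note mra = assms(4) and supp = assms(5)
  have fin: "finite (refinement_support \<phi>)" by (rule finite_refinement_support[OF supp])
  have int: "integrable lebesgue \<phi>"
    by (rule L2_integrable_compact_support[OF MRA_orthonormal(2)[OF mra] compact_cbox supp])
  have "\<forall>\<xi>. m0 \<xi> = wchar \<xi> (2 *\<^sub>R P) * m0 (- \<xi>)" if "AE x in lebesgue. \<phi> x = \<phi> (2 *\<^sub>R P - x)"
    using filter_symmetric_if_symmetric[OF mra fin that[unfolded \<kappa>]] unfolding assms(6) \<kappa> by (rule allI)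
  moreover have "\<forall>\<xi>. qft \<phi> \<xi> = wchar \<xi> (2 *\<^sub>R P) * qft \<phi> (- \<xi>)" if "\<forall>\<xi>. m0 \<xi> = wchar \<xi> (2 *\<^sub>R P) * m0 (- \<xi>)"
    using qft_symmetric_if_filter_symmetric[OF mra fin int bounded_cbox supp, of "2 *\<^sub>R P"] that
    unfolding assms(6) by blast
  moreover have "AE x in lebesgue. \<phi> x = \<phi> (2 *\<^sub>R P - x)" if "\<forall>\<xi>. qft \<phi> \<xi> = wchar \<xi> (2 *\<^sub>R P) * qft \<phi> (- \<xi>)"
    using symmetric_if_qft_symmetric[OF int compact_cbox supp, of "2 *\<^sub>R P"] that by blast
  ultimately show ?thesis unfolding w by blast
qed

end
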